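(* Let $p,q\in\mathbb D^2$ be two distinct points. Then $$c_{\mathbb D^2}(z;p,q)=l_{\mathbb D^2}(z;p,q)\quad\text{for all } z\in\mathbb D^2 .$$
   Context: $\mathbb D$ denotes the open unit disc in $\mathbb C$ and $\mathbb D^2$ the bidisc. For a domain $D\subset\mathbb C^n$, pairwise distinct poles $p_1,\dots,p_N\in D$ and $z\in D$: the Lempert function (with all weights equal to $1$) is $l_D(z;p_1,\dots,p_N):=\inf\{\sum_{j=1}^N\log|\lambda_j|\}$, the infimum taken over all holomorphic $\psi:\mathbb D\to D$ and $\lambda_1,\dots,\lambda_N\in\mathbb D$ with $\psi(0)=z$ and $\psi(\lambda_j)=p_j$, $j=1,\dots,N$; the Carathéodory function is $c_D(z;p_1,\dots,p_N):=\sup\{\log|F(z)| : F:D\to\mathbb D \text{ holomorphic},\ F(p_j)=0,\ j=1,\dots,N\}$. *)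

theory Defs
  imports "HOL-Analysis.Analysis"
begin

definition bidisc :: "(complex \<times> complex) set" where
  "bidisc = ball 0 1 \<times> ball 0 1"

definition clinear2 :: "(complex \<times> complex \<Rightarrow> complex) \<Rightarrow> bool" where
  "clinear2 L \<longleftrightarrow> (\<forall>u v. L (u + v) = L u + L v) \<and>
                   (\<forall>c v. L (c * fst v, c * snd v) = c * L v)"

definition holomorphic2_on :: "(complex \<times> complex \<Rightarrow> complex) \<Rightarrow> (complex \<times> complex) set \<Rightarrow> bool" where
  "holomorphic2_on F S \<longleftrightarrow> (\<forall>w\<in>S. \<exists>L. (F has_derivative L) (at w) \<and> clinear2 L)"

definition holomorphic_map2_on :: "(complex \<Rightarrow> complex \<times> complex) \<Rightarrow> complex set \<Rightarrow> bool" where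
  "holomorphic_map2_on \<psi> S \<longleftrightarrow> (\<lambda>t. fst (\<psi> t)) holomorphic_on S \<and> (\<lambda>t. snd (\<psi> t)) holomorphic_on S"

definition elog :: "real \<Rightarrow> ereal" where
  "elog x = (if x = 0 then -\<infinity> else ereal (ln x))"

definition lempert2 :: "(complex \<times> complex) set \<Rightarrow> complex \<times> complex \<Rightarrow> complex \<times> complex
                          \<Rightarrow> complex \<times> complex \<Rightarrow> ereal" where
  "lempert2 D z p q = Inf {elog (norm a1) + elog (norm a2) | a1 a2 \<psi>.
      holomorphic_map2_on \<psi> (ball 0 1) \<and> \<psi> ` ball 0 1 \<subseteq> D \<and>
      a1 \<in> ball 0 1 \<and> a2 \<in> ball 0 1 \<and> \<psi> 0 = z \<and> \<psi> a1 = p \<and> \<psi> a2 = q}"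

definition carath2 :: "(complex \<times> complex) set \<Rightarrow> complex \<times> complex \<Rightarrow> complex \<times> complex
                          \<Rightarrow> complex \<times> complex \<Rightarrow> ereal" where
  "carath2 D z p q = Sup {elog (norm (F z)) | F.
      holomorphic2_on F D \<and> F ` D \<subseteq> ball 0 1 \<and> F p = 0 \<and> F q = 0}"

end

theory Submission
  imports Defs "HOL-Complex_Analysis.Complex_Analysis"
begin

text \<open>
  Let the base point be \<open>0\<close>. By Pick's theorem the infimum defining the Lempert function is the
  minimum of \<open>|l m|\<close> over the pairs of nodes \<open>(l, m)\<close> in the closed disc that satisfy one Pick inequality
  for each coordinate.

  If a coordinate of an optimal disc is a rotation, then a Blaschke product in that coordinate attains the
  same value. Otherwise every active inequality determines an extremal disc
  \<open>t \<mapsto> h t (t - a) / (1 - cnj a t)\<close>, and the first variation of the inequality, in a suitable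
  normalisation, is an affine function of \<open>a\<close>; the first variation of \<open>|l m|\<close> is the value of the same affine
  function at the point \<open>b\<close> for which the disc with zero \<open>b\<close> identifies \<open>l\<close> and \<open>m\<close>. At a minimum, \<open>b\<close>
  therefore lies in the convex hull of the zeros \<open>a\<close>. After rotations of the coordinates the two extremal discs
  take the value \<open>1\<close> at the same two points of the circle, so that the convex combination
  can be formed in the half-plane model: it is a function on the bidisc that takes equal values of modulus
  \<open>|l m|\<close> at both poles, and composing it with an automorphism of the disc gives the extremal function.

  If a node of the optimal pair lies on the circle, the same separation argument applies to the position of a
  segment relative to the unit disc.
\<close>

subsection \<open>Holomorphic functions of two variables\<close>

text \<open>The inequality \<open>carath2\<close> \<le> \<open>lempert2\<close> only uses that a
  holomorphic self-map of the disc with distinct zeros \<open>a\<close>, \<open>b\<close> is bounded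
  by |a b| at 0. The reverse inequality needs an explicit function on the bidisc, and its data have
  to be read off from the minimality of |l m|, although the Pick inequalities are not convex in the
  nodes. What makes this possible is that under the perturbation \<open>l * (1 + e * u)\<close>,
  \<open>m * (1 + e * v)\<close> every active inequality has the same slope, up to a positive
  factor, as a form in \<open>u\<close>, \<open>v\<close> whose weights depend on \<open>l\<close>,
  \<open>m\<close> alone; the coordinate enters only through its zero \<open>a\<close>. A direction
  thus amounts to a real affine function on the plane of zeros, and stationarity becomes a
  separation statement there. A minimum of that kind has the value max(|fst q|, |snd q|) when
  \<open>l\<close> is the unimodular node, and only one-sided variations, with \<open>l\<close>
  moving inwards, are available.\<close>

lemma clinear2_const_mult_add:
  assumes "clinear2 L" "clinear2 M"
  shows "clinear2 (\<lambda>v. a * L v + b * M v)"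
  using assms by (auto simp: clinear2_def algebra_simps)

lemma holomorphic2_on_fst: "holomorphic2_on fst S"
  unfolding holomorphic2_on_def
  by (intro ballI exI[of _ fst] conjI has_derivative_fst[OF has_derivative_ident])
     (auto simp: clinear2_def)

lemma holomorphic2_on_snd: "holomorphic2_on snd S"
  unfolding holomorphic2_on_def
  by (intro ballI exI[of _ snd] conjI has_derivative_snd[OF has_derivative_ident])
     (auto simp: clinear2_def)

lemma holomorphic2_on_compose:
  assumes F: "holomorphic2_on F S" and f: "f holomorphic_on T" "open T"
    and sub: "\<And>v. v \<in> S \<Longrightarrow> F v \<in> T"
  shows "holomorphic2_on (\<lambda>v. f (F v)) S"
  unfolding holomorphic2_on_def
proof
  fix w assume w: "w \<in> S"
  obtain L where L: "(F has_derivative L) (at w)" "clinear2 L"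
    using F w by (auto simp: holomorphic2_on_def)
  have "(f has_field_derivative deriv f (F w)) (at (F w))"
    using f sub[OF w] holomorphic_derivI by blast
  then have "(f has_derivative (\<lambda>x. deriv f (F w) * x)) (at (F w))"
    by (simp add: has_field_derivative_def)
  from has_derivative_compose[OF L(1) this] L(2)
  show "\<exists>L. ((\<lambda>v. f (F v)) has_derivative L) (at w) \<and> clinear2 L"
    using clinear2_const_mult_add[OF L(2) L(2), of "deriv f (F w)" 0] by auto
qed

lemma holomorphic2_on_mult:
  assumes "holomorphic2_on F S" "holomorphic2_on G S"
  shows "holomorphic2_on (\<lambda>v. F v * G v) S"
  unfolding holomorphic2_on_def
proof
  fix w assume w: "w \<in> S"
  obtain L M where L: "(F has_derivative L) (at w)" "clinear2 L"
    and M: "(G has_derivative M) (at w)" "clinear2 M"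
    using assms w by (fastforce simp: holomorphic2_on_def)
  have "((\<lambda>v. F v * G v) has_derivative (\<lambda>v. F w * M v + L v * G w)) (at w)"
    by (rule has_derivative_mult[OF L(1) M(1)])
  then show "\<exists>L. ((\<lambda>v. F v * G v) has_derivative L) (at w) \<and> clinear2 L"
    using clinear2_const_mult_add[OF M(2) L(2), of "F w" "G w"] by (auto simp: mult.commute)
qed

lemma holomorphic2_on_add:
  assumes "holomorphic2_on F S" "holomorphic2_on G S"
  shows "holomorphic2_on (\<lambda>v. F v + G v) S"
  unfolding holomorphic2_on_def
proof
  fix w assume w: "w \<in> S"
  obtain L M where L: "(F has_derivative L) (at w)" "clinear2 L"
    and M: "(G has_derivative M) (at w)" "clinear2 M"
    using assms w by (fastforce simp: holomorphic2_on_def)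
  show "\<exists>L. ((\<lambda>v. F v + G v) has_derivative L) (at w) \<and> clinear2 L"
    using has_derivative_add[OF L(1) M(1)] clinear2_const_mult_add[OF L(2) M(2), of 1 1] by auto
qed

lemma has_derivative_coordinate_map:
  fixes f g :: "complex \<Rightarrow> complex"
  assumes "(f has_field_derivative f') (at (fst w))" "(g has_field_derivative g') (at (snd w))"
  shows "((\<lambda>v. (f (fst v), g (snd v))) has_derivative (\<lambda>v. (f' * fst v, g' * snd v))) (at w)"
proof -
  have "((\<lambda>v. f (fst v)) has_derivative (\<lambda>v. f' * fst v)) (at w)"
    using has_derivative_compose[OF has_derivative_fst[OF has_derivative_ident]] assms(1)
    unfolding has_field_derivative_def by blast
  moreover have "((\<lambda>v. g (snd v)) has_derivative (\<lambda>v. g' * snd v)) (at w)"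
    using has_derivative_compose[OF has_derivative_snd[OF has_derivative_ident]] assms(2)
    unfolding has_field_derivative_def by blast
  ultimately show ?thesis by (rule has_derivative_Pair)
qed

lemma holomorphic2_on_coordinate_map:
  assumes F: "holomorphic2_on F bidisc"
    and f: "f holomorphic_on ball 0 1" "f ` ball 0 1 \<subseteq> ball 0 1"
    and g: "g holomorphic_on ball 0 1" "g ` ball 0 1 \<subseteq> ball 0 1"
  shows "holomorphic2_on (\<lambda>v. F (f (fst v), g (snd v))) bidisc"
  unfolding holomorphic2_on_def
proof
  fix w assume "w \<in> bidisc"
  then have w: "fst w \<in> ball 0 1" "snd w \<in> ball 0 1"
    by (auto simp: bidisc_def)
  define h where "h = (\<lambda>v::complex\<times>complex. (f (fst v), g (snd v)))"
  have "h w \<in> bidisc"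
    using w f g unfolding h_def bidisc_def by blast
  then obtain L where L: "(F has_derivative L) (at (h w))" "clinear2 L"
    using F by (auto simp: holomorphic2_on_def)
  have "(h has_derivative (\<lambda>v. (deriv f (fst w) * fst v, deriv g (snd w) * snd v))) (at w)"
    unfolding h_def using f g w
    by (intro has_derivative_coordinate_map) (meson holomorphic_derivI open_ball)+
  from has_derivative_compose[OF this L(1)]
  have "((\<lambda>v. F (h v)) has_derivative
      (\<lambda>v. L (deriv f (fst w) * fst v, deriv g (snd w) * snd v))) (at w)" .
  moreover have "clinear2 (\<lambda>v. L (deriv f (fst w) * fst v, deriv g (snd w) * snd v))"
    unfolding clinear2_def
  proof (intro conjI allI)
    fix u v :: "complex \<times> complex" and c
    have add: "L (x + y) = L x + L y" and scale: "L (c * fst x, c * snd x) = c * L x" for x y c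
      using L(2) unfolding clinear2_def by blast+
    show "L (deriv f (fst w) * fst (u + v), deriv g (snd w) * snd (u + v)) =
      L (deriv f (fst w) * fst u, deriv g (snd w) * snd u) +
      L (deriv f (fst w) * fst v, deriv g (snd w) * snd v)"
      by (simp add: add[symmetric] algebra_simps)
    show "L (deriv f (fst w) * fst (c * fst v, c * snd v), deriv g (snd w) * snd (c * fst v, c * snd v)) =
      c * L (deriv f (fst w) * fst v, deriv g (snd w) * snd v)"
      using scale[of c "(deriv f (fst w) * fst v, deriv g (snd w) * snd v)"]
      by (simp add: algebra_simps)
  qed
  ultimately show "\<exists>L. ((\<lambda>v. F (f (fst v), g (snd v))) has_derivative L) (at w) \<and> clinear2 L"
    unfolding h_def by blast
qed

lemma holomorphic_on_disc_composition:
  assumes F: "holomorphic2_on F bidisc"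
    and \<psi>: "holomorphic_map2_on \<psi> (ball 0 1)" "\<psi> ` ball 0 1 \<subseteq> bidisc"
  shows "(\<lambda>t. F (\<psi> t)) holomorphic_on ball 0 1"
proof (rule holomorphic_onI)
  fix t :: complex assume t: "t \<in> ball 0 1"
  define d1 where "d1 = deriv (\<lambda>t. fst (\<psi> t)) t"
  define d2 where "d2 = deriv (\<lambda>t. snd (\<psi> t)) t"
  have "((\<lambda>t. fst (\<psi> t)) has_derivative (\<lambda>x. d1 * x)) (at t)"
       "((\<lambda>t. snd (\<psi> t)) has_derivative (\<lambda>x. d2 * x)) (at t)"
    using \<psi>(1) t unfolding d1_def d2_def holomorphic_map2_on_def has_field_derivative_def[symmetric]
    by (meson holomorphic_derivI open_ball)+
  from has_derivative_Pair[OF this]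
  have D: "(\<psi> has_derivative (\<lambda>x. (d1 * x, d2 * x))) (at t)" by simp
  obtain L where L: "(F has_derivative L) (at (\<psi> t))" "clinear2 L"
    using F \<psi>(2) t unfolding holomorphic2_on_def by blast
  have "L (d1 * x, d2 * x) = L (d1, d2) * x" for x
    using L(2) unfolding clinear2_def by (metis fst_conv snd_conv mult.commute)
  then have "((\<lambda>t. F (\<psi> t)) has_field_derivative L (d1, d2)) (at t)"
    using has_derivative_compose[OF D L(1)] by (simp add: has_field_derivative_def)
  then show "(\<lambda>t. F (\<psi> t)) field_differentiable at t within ball 0 1"
    using field_differentiable_def field_differentiable_at_within by blast
qed

subsection \<open>The inequality between the two functions\<close>

lemma one_minus_cnj_mult_nonzero:
  assumes "cmod a < 1" "cmod z \<le> 1"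
  shows "1 - cnj a * z \<noteq> 0"
proof
  assume "1 - cnj a * z = 0"
  then have "cmod a * cmod z = 1"
    by (metis complex_mod_cnj norm_mult norm_one right_minus_eq)
  moreover have "cmod a * cmod z \<le> cmod a * 1"
    using assms by (intro mult_left_mono) auto
  ultimately show False using assms by simp
qed

lemma Moebius_function_cancel:
  assumes "cmod a < 1" "cmod z < 1"
  shows "Moebius_function 0 a (Moebius_function 0 (-a) z) = z"
    and "Moebius_function 0 (-a) (Moebius_function 0 a z) = z"
  using assms by (auto intro!: Moebius_function_compose)

text \<open>The bound on \<open>g\<close> is not strict because the lemma is applied to a quotient
  f(z)/z, for which Schwarz's lemma gives only \<le> 1. Scaling by \<open>c < 1\<close> restores the
  strict bound that Schwarz's lemma requires; then \<open>c\<close> tends to 1.\<close>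

lemma schwarz_pick_zero:
  assumes g: "g holomorphic_on ball 0 1" "\<And>t. cmod t < 1 \<Longrightarrow> cmod (g t) \<le> 1"
    and a: "cmod a < 1" "g a = 0" and t: "cmod t < 1"
  shows "cmod (g t) \<le> cmod (Moebius_function 0 a t)"
proof -
  define M where "M = Moebius_function 0 (-a)"
  have M: "M holomorphic_on ball 0 1" "\<And>t. cmod t < 1 \<Longrightarrow> cmod (M t) < 1" "M 0 = a"
    using a unfolding M_def
    by (auto simp: Moebius_function_of_zero intro: Moebius_function_norm_lt_1 Moebius_function_holomorphic)
  define s where "s = Moebius_function 0 a t"
  have s: "cmod s < 1" "M s = t"
    using a t Moebius_function_cancel(2) by (auto simp: s_def M_def Moebius_function_norm_lt_1)
  have "c * cmod (g t) \<le> cmod s" if c: "0 < c" "c < 1" for c :: real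
  proof -
    define k where "k = (\<lambda>t. of_real c * g (M t))"
    have "(g \<circ> M) holomorphic_on ball 0 1"
      using M g by (intro holomorphic_on_compose_gen[of M _ g "ball 0 1"]) auto
    then have "k holomorphic_on ball 0 1"
      unfolding k_def o_def by (intro holomorphic_intros)
    moreover have "k 0 = 0" using M a by (simp add: k_def)
    moreover have "cmod (k u) < 1" if "cmod u < 1" for u
    proof -
      have "c * cmod (g (M u)) \<le> c * 1"
        using c g(2)[OF M(2)[OF that]] by (intro mult_left_mono) auto
      with c have "c * cmod (g (M u)) < 1" by linarith
      then show ?thesis using c by (simp add: k_def norm_mult)
    qed
    ultimately have "cmod (k s) \<le> cmod s"
      using Schwarz_Lemma(1)[of k s] s by blast
    then show ?thesis using c s by (simp add: k_def norm_mult)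
  qed
  then have "eventually (\<lambda>c. c * cmod (g t) \<le> cmod s) (at_left 1)"
    unfolding eventually_at_left_field by (intro exI[of _ 0]) auto
  moreover have "((\<lambda>c. c * cmod (g t)) \<longlongrightarrow> 1 * cmod (g t)) (at_left 1)"
    by (intro tendsto_intros)
  ultimately have "1 * cmod (g t) \<le> cmod s"
    by (intro tendsto_upperbound[where F = "at_left (1::real)"]) auto
  then show ?thesis by (simp add: s_def)
qed

text \<open>An automorphism moves the zero \<open>a\<close> to 0, where it is divided out; the
  Schwarz-Pick estimate for the quotient at its remaining zero gives the second factor.\<close>

lemma holomorphic_two_zeros_bound:
  assumes g: "g holomorphic_on ball 0 1" "\<And>t. cmod t < 1 \<Longrightarrow> cmod (g t) < 1"
    and ab: "cmod a < 1" "cmod b < 1" "a \<noteq> b" "g a = 0" "g b = 0"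
  shows "cmod (g 0) \<le> cmod a * cmod b"
proof (cases "a = 0")
  case True
  then show ?thesis using ab by simp
next
  case False
  define M where "M = Moebius_function 0 (-a)"
  have M: "M holomorphic_on ball 0 1" "\<And>t. cmod t < 1 \<Longrightarrow> cmod (M t) < 1" "M 0 = a"
    using ab unfolding M_def
    by (auto simp: Moebius_function_of_zero intro: Moebius_function_norm_lt_1 Moebius_function_holomorphic)
  define f where "f = g \<circ> M"
  have f: "f holomorphic_on ball 0 1"
    unfolding f_def using M g by (intro holomorphic_on_compose_gen[of M _ g "ball 0 1"]) auto
  have f0: "f 0 = 0" and fb: "\<And>t. cmod t < 1 \<Longrightarrow> cmod (f t) < 1"
    using M g ab by (auto simp: f_def)
  obtain h where h: "h holomorphic_on ball 0 1" "\<And>z. cmod z < 1 \<Longrightarrow> f z = z * h z" "deriv f 0 = h 0"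
    using Schwarz3[OF f f0] by blast
  have h1: "cmod (h z) \<le> 1" if "cmod z < 1" for z
  proof (cases "z = 0")
    case True
    then show ?thesis using Schwarz_Lemma(2)[of f 0] f f0 fb h by auto
  next
    case False
    have "cmod (f z) \<le> cmod z"
      using Schwarz_Lemma(1)[of f z] f f0 fb that by auto
    then show ?thesis using False h(2)[OF that] by (simp add: norm_mult)
  qed
  define c where "c = Moebius_function 0 a b"
  have c: "cmod c < 1" "M c = b"
    using ab Moebius_function_cancel(2) by (auto simp: c_def M_def Moebius_function_norm_lt_1)
  have "c \<noteq> 0" using c M ab by auto
  then have hc: "h c = 0" using h(2)[OF c(1)] c ab by (simp add: f_def)
  have ma: "cmod (-a) < 1" "M (-a) = 0"
    using ab by (auto simp: M_def Moebius_function_simple)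
  have "cmod (g 0) = cmod a * cmod (h (-a))"
    using h(2)[OF ma(1)] ma(2) by (simp add: f_def norm_mult)
  also have "\<dots> \<le> cmod a * cmod (Moebius_function 0 c (-a))"
    using schwarz_pick_zero[OF h(1) h1 c(1) hc ma(1)] by (intro mult_left_mono) auto
  \<comment> \<open>This is the invariance of the pseudohyperbolic distance: \<open>M\<close> sends
    \<open>c\<close> to \<open>b\<close> and \<open>-a\<close> to 0.\<close>
  also have "cmod (Moebius_function 0 c (-a)) = cmod b"
  proof -
    have n1: "1 - cnj a * b \<noteq> 0" "1 - a * cnj b \<noteq> 0" "1 - cnj a * a \<noteq> 0"
      using one_minus_cnj_mult_nonzero[of a b] one_minus_cnj_mult_nonzero[of b a]
        one_minus_cnj_mult_nonzero[of a a] ab by (auto simp: mult.commute)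
    have num: "- a - c = - b * (1 - cnj a * a) / (1 - cnj a * b)"
      unfolding c_def Moebius_function_simple using n1 by (simp add: field_simps)
    have den: "1 + cnj c * a = (1 - cnj a * a) / (1 - a * cnj b)"
      unfolding c_def Moebius_function_simple using n1 by (simp add: field_simps)
    have "cmod (1 - a * cnj b) = cmod (1 - cnj a * b)"
      by (metis complex_cnj_cnj complex_cnj_diff complex_cnj_mult complex_cnj_one complex_mod_cnj)
    then show ?thesis
      unfolding Moebius_function_simple using num den n1
      by (simp add: norm_divide norm_mult)
  qed
  finally show ?thesis .
qed

lemma elog_mono: "0 \<le> x \<Longrightarrow> x \<le> y \<Longrightarrow> elog x \<le> elog y"
  by (auto simp: elog_def)

lemma elog_mult: "0 \<le> x \<Longrightarrow> 0 \<le> y \<Longrightarrow> elog (x * y) = elog x + elog y"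
  by (auto simp: elog_def ln_mult)

text \<open>Composing a competitor \<open>F\<close> with a competing disc reduces the claim to one
  variable. Distinct poles make the two nodes distinct, so that the composition really has two
  zeros.\<close>

lemma carath2_le_lempert2:
  assumes "p \<noteq> q"
  shows "carath2 bidisc z p q \<le> lempert2 bidisc z p q"
  unfolding carath2_def lempert2_def
proof (intro Sup_least Inf_greatest, clarify)
  fix F a1 a2 \<psi>
  assume F: "holomorphic2_on F bidisc" "F ` bidisc \<subseteq> ball 0 1" "F (\<psi> a1) = 0" "F (\<psi> a2) = 0"
    and \<psi>: "holomorphic_map2_on \<psi> (ball 0 1)" "\<psi> ` ball 0 1 \<subseteq> bidisc"
    and a: "a1 \<in> ball 0 1" "a2 \<in> ball 0 1" and pq: "p = \<psi> a1" "q = \<psi> a2"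
  have "cmod (F (\<psi> 0)) \<le> cmod a1 * cmod a2"
  proof (rule holomorphic_two_zeros_bound)
    show "(\<lambda>t. F (\<psi> t)) holomorphic_on ball 0 1"
      by (rule holomorphic_on_disc_composition[OF F(1) \<psi>])
    show "cmod (F (\<psi> t)) < 1" if "cmod t < 1" for t
    proof -
      have "\<psi> t \<in> bidisc" using \<psi>(2) that by auto
      then have "F (\<psi> t) \<in> ball 0 1" using F(2) by blast
      then show ?thesis by simp
    qed
  qed (use a F assms pq in auto)
  then show "elog (cmod (F (\<psi> 0))) \<le> elog (cmod a1) + elog (cmod a2)"
    by (simp add: elog_mono flip: elog_mult)
qed

subsection \<open>Moving the base point to the origin\<close>

definition bidisc_moebius :: "complex \<times> complex \<Rightarrow> complex \<times> complex \<Rightarrow> complex \<times> complex" where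
  "bidisc_moebius c v = (Moebius_function 0 (fst c) (fst v), Moebius_function 0 (snd c) (snd v))"

lemma mem_bidisc: "v \<in> bidisc \<longleftrightarrow> cmod (fst v) < 1 \<and> cmod (snd v) < 1"
  by (cases v) (simp add: bidisc_def)

lemma bidisc_moebius_mem: "c \<in> bidisc \<Longrightarrow> v \<in> bidisc \<Longrightarrow> bidisc_moebius c v \<in> bidisc"
  by (simp add: bidisc_moebius_def mem_bidisc Moebius_function_norm_lt_1)

lemma bidisc_moebius_cancel:
  "c \<in> bidisc \<Longrightarrow> v \<in> bidisc \<Longrightarrow> bidisc_moebius (-c) (bidisc_moebius c v) = v"
  by (simp add: bidisc_moebius_def mem_bidisc Moebius_function_cancel)

lemma bidisc_moebius_self: "bidisc_moebius c c = 0"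
  by (simp add: bidisc_moebius_def Moebius_function_eq_zero zero_prod_def)

lemma uminus_mem_bidisc: "c \<in> bidisc \<Longrightarrow> - c \<in> bidisc"
  by (simp add: mem_bidisc)

lemma Moebius_function_holomorphic_compose:
  assumes "f holomorphic_on ball 0 1" "f ` ball 0 1 \<subseteq> ball 0 1" "cmod a < 1"
  shows "(\<lambda>t. Moebius_function 0 a (f t)) holomorphic_on ball 0 1"
  using holomorphic_on_compose_gen[OF assms(1) Moebius_function_holomorphic[OF assms(3)] assms(2)]
  by (simp add: o_def)

text \<open>The inverse automorphism \<open>bidisc_moebius (-z)\<close> carries each disc through
  the origin to a disc through \<open>z\<close> with the same nodes, hence with the same
  value.\<close>

lemma lempert2_le_recentered:
  assumes z: "z \<in> bidisc" and pq: "p \<in> bidisc" "q \<in> bidisc"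
  shows "lempert2 bidisc z p q \<le> lempert2 bidisc 0 (bidisc_moebius z p) (bidisc_moebius z q)"
  unfolding lempert2_def
proof (rule Inf_superset_mono, clarify)
  fix a1 a2 \<psi>
  assume \<psi>: "holomorphic_map2_on \<psi> (ball 0 1)" "\<psi> ` ball 0 1 \<subseteq> bidisc" "\<psi> 0 = 0"
    and a: "a1 \<in> ball 0 1" "a2 \<in> ball 0 1"
    and v: "\<psi> a1 = bidisc_moebius z p" "\<psi> a2 = bidisc_moebius z q"
  let ?\<theta> = "\<lambda>t. bidisc_moebius (-z) (\<psi> t)"
  have mz: "- z \<in> bidisc" using z by (rule uminus_mem_bidisc)
  have sub: "(\<lambda>t. fst (\<psi> t)) ` ball 0 1 \<subseteq> ball 0 1" "(\<lambda>t. snd (\<psi> t)) ` ball 0 1 \<subseteq> ball 0 1"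
    using \<psi>(2) by (force simp: bidisc_def)+
  have hol: "(\<lambda>t. fst (\<psi> t)) holomorphic_on ball 0 1" "(\<lambda>t. snd (\<psi> t)) holomorphic_on ball 0 1"
    using \<psi>(1) by (auto simp: holomorphic_map2_on_def)
  have "holomorphic_map2_on ?\<theta> (ball 0 1)"
    unfolding holomorphic_map2_on_def bidisc_moebius_def fst_conv snd_conv using mz
    by (intro conjI Moebius_function_holomorphic_compose[OF hol(1) sub(1)]
         Moebius_function_holomorphic_compose[OF hol(2) sub(2)]) (simp_all add: mem_bidisc)
  moreover have "?\<theta> ` ball 0 1 \<subseteq> bidisc"
    using \<psi>(2) mz bidisc_moebius_mem by blast
  moreover have "?\<theta> 0 = z" "?\<theta> a1 = p" "?\<theta> a2 = q"
    using \<psi>(3) v z pq bidisc_moebius_cancel[OF z z] by (auto simp: bidisc_moebius_cancel bidisc_moebius_self)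
  ultimately show "\<exists>b1 b2 \<theta>. elog (cmod a1) + elog (cmod a2) = elog (cmod b1) + elog (cmod b2) \<and>
      holomorphic_map2_on \<theta> (ball 0 1) \<and> \<theta> ` ball 0 1 \<subseteq> bidisc \<and>
      b1 \<in> ball 0 1 \<and> b2 \<in> ball 0 1 \<and> \<theta> 0 = z \<and> \<theta> b1 = p \<and> \<theta> b2 = q"
    using a by blast
qed

lemma carath2_recentered_le:
  assumes z: "z \<in> bidisc" and pq: "p \<in> bidisc" "q \<in> bidisc"
  shows "carath2 bidisc 0 (bidisc_moebius z p) (bidisc_moebius z q) \<le> carath2 bidisc z p q"
  unfolding carath2_def
proof (rule Sup_subset_mono, clarify)
  fix F
  assume F: "holomorphic2_on F bidisc" "F ` bidisc \<subseteq> ball 0 1"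
    "F (bidisc_moebius z p) = 0" "F (bidisc_moebius z q) = 0"
  let ?H = "\<lambda>v. F (bidisc_moebius z v)"
  have "holomorphic2_on ?H bidisc"
    unfolding bidisc_moebius_def using z
    by (intro holomorphic2_on_coordinate_map[OF F(1)])
       (auto simp: mem_bidisc Moebius_function_norm_lt_1 intro: Moebius_function_holomorphic)
  moreover have "?H ` bidisc \<subseteq> ball 0 1"
    using F(2) bidisc_moebius_mem[OF z] by blast
  moreover have "?H z = F 0" by (simp add: bidisc_moebius_self)
  ultimately show "\<exists>H. elog (cmod (F 0)) = elog (cmod (H z)) \<and> holomorphic2_on H bidisc \<and>
      H ` bidisc \<subseteq> ball 0 1 \<and> H p = 0 \<and> H q = 0"
    using F by (intro exI[of _ ?H]) auto
qed

subsection \<open>Lower bounds for the Caratheodory function\<close>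

lemma carath2_upper:
  assumes "holomorphic2_on F bidisc" "\<And>v. v \<in> bidisc \<Longrightarrow> cmod (F v) < 1" "F p = 0" "F q = 0"
  shows "elog (cmod (F z)) \<le> carath2 bidisc z p q"
  unfolding carath2_def using assms by (intro Sup_upper) force

text \<open>The conformal map of the disc onto the right half-plane with 0 going to 1 and 1 to
  infinity. The half-plane is a convex cone, so weighted means of such values stay in it.\<close>

definition cayley :: "complex \<Rightarrow> complex" where
  "cayley z = (1 + z) / (1 - z)"

lemma Re_cayley_pos:
  assumes "cmod z < 1"
  shows "Re (cayley z) > 0"
proof -
  have "(Re z)\<^sup>2 + (Im z)\<^sup>2 < 1"
    using assms by (metis cmod_power2 norm_ge_zero one_power2 power2_less_imp_less power_mono_iff
        abs_norm_cancel abs_square_less_1)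
  then show ?thesis
    unfolding cayley_def Re_complex_div_gt_0 by (simp add: algebra_simps power2_eq_square)
qed

lemma half_plane_to_disc:
  assumes "Re g > 0" "Re c > 0"
  shows "g + cnj c \<noteq> 0" "cmod ((g - c) / (g + cnj c)) < 1"
proof -
  show nz: "g + cnj c \<noteq> 0"
    using assms by (auto simp: complex_eq_iff)
  have "(cmod (g + cnj c))\<^sup>2 - (cmod (g - c))\<^sup>2 = 4 * (Re g * Re c)"
    unfolding cmod_power2 by (simp add: power2_eq_square algebra_simps)
  then have "(cmod (g - c))\<^sup>2 < (cmod (g + cnj c))\<^sup>2"
    using assms mult_pos_pos[of "Re g" "Re c"] by linarith
  then have "cmod (g - c) < cmod (g + cnj c)"
    by (rule power2_less_imp_less) simp
  then show "cmod ((g - c) / (g + cnj c)) < 1"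
    using nz by (simp add: norm_divide)
qed

text \<open>The mean is taken in half-plane coordinates in which the boundary points \<open>cnj u1\<close> and
  \<open>cnj u2\<close> of the two factors lie at infinity.\<close>

lemma carath2_ge_cayley_mean:
  fixes t :: real
  assumes t: "0 \<le> t" "t \<le> 1" and w: "cmod w < 1" and u: "cmod u1 = 1" "cmod u2 = 1"
    and p: "t * cayley (u1 * fst p) + (1 - t) * cayley (u2 * snd p) = cayley w"
    and q: "t * cayley (u1 * fst q) + (1 - t) * cayley (u2 * snd q) = cayley w"
  shows "elog (cmod w) \<le> carath2 bidisc 0 p q"
proof -
  define g where "g = (\<lambda>v. t * cayley (u1 * fst v) + (1 - t) * cayley (u2 * snd v))"
  define c where "c = cayley w"
  \<comment> \<open>The half-plane is mapped back to the disc with the common value \<open>c\<close>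
    of \<open>g\<close> at both poles going to 0. Since \<open>g 0 = 1\<close>, the value at the
    origin has modulus |w|.\<close>
  define F where "F = (\<lambda>v. (g v - c) / (g v + cnj c))"
  have c: "Re c > 0" using w by (simp add: c_def Re_cayley_pos)
  have cay: "(\<lambda>x. of_real s * cayley (u * x)) holomorphic_on ball 0 1" if "cmod u = 1" for u and s :: real
    unfolding cayley_def using that
    by (intro holomorphic_intros) (auto simp: norm_mult dest!: arg_cong[of _ _ cmod])
  have g: "Re (g v) > 0" if "v \<in> bidisc" for v
  proof -
    have "Re (cayley (u1 * fst v)) > 0" "Re (cayley (u2 * snd v)) > 0"
      using that u by (auto simp: mem_bidisc norm_mult intro!: Re_cayley_pos)
    then have "t * Re (cayley (u1 * fst v)) + (1 - t) * Re (cayley (u2 * snd v)) > 0"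
      using t by (cases "t = 0") (auto intro!: add_pos_nonneg)
    then show ?thesis by (simp add: g_def)
  qed
  have "holomorphic2_on (\<lambda>v. of_real t * cayley (u1 * fst v)) bidisc"
       "holomorphic2_on (\<lambda>v. of_real (1 - t) * cayley (u2 * snd v)) bidisc"
    by (rule holomorphic2_on_compose[OF holomorphic2_on_fst cay[OF u(1)] open_ball]
          holomorphic2_on_compose[OF holomorphic2_on_snd cay[OF u(2)] open_ball],
        simp add: mem_bidisc)+
  from holomorphic2_on_add[OF this] have gh: "holomorphic2_on g bidisc"
    unfolding g_def by simp
  have "(\<lambda>x. (x - c) / (x + cnj c)) holomorphic_on {x. Re x > 0}"
    using c half_plane_to_disc(1) by (intro holomorphic_intros) auto
  then have "holomorphic2_on F bidisc"
    unfolding F_def using g by (intro holomorphic2_on_compose[OF gh]) (auto simp: open_halfspace_Re_gt)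
  moreover have "cmod (F v) < 1" if "v \<in> bidisc" for v
    unfolding F_def using half_plane_to_disc(2)[OF g[OF that] c] .
  moreover have "F p = 0" "F q = 0"
    using p q by (auto simp: F_def g_def c_def)
  ultimately have "elog (cmod (F 0)) \<le> carath2 bidisc 0 p q"
    by (rule carath2_upper)
  moreover have "cmod (F 0) = cmod w"
  proof -
    have "1 - w \<noteq> 0" using w by auto
    have g0: "g 0 = 1" by (simp add: g_def cayley_def)
    have "cmod (1 + cnj c) = cmod (1 + c)"
      by (metis complex_cnj_add complex_cnj_one complex_mod_cnj)
    then have "cmod (F 0) = cmod ((1 - c) / (1 + c))"
      by (simp add: F_def g0 norm_divide)
    also have "(1 - c) / (1 + c) = - w"
      unfolding c_def cayley_def using \<open>1 - w \<noteq> 0\<close> by (simp add: field_simps)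
    finally show ?thesis by simp
  qed
  ultimately show ?thesis by simp
qed

text \<open>The mean with weight 1 on the first coordinate: the coordinate function itself already
  takes one value at both poles.\<close>

lemma carath2_ge_fst_eq:
  assumes "p \<in> bidisc" "fst p = fst q"
  shows "elog (cmod (fst q)) \<le> carath2 bidisc 0 p q"
  using assms carath2_ge_cayley_mean[of 1 "fst q" 1 1 p q] by (simp add: mem_bidisc)

lemma carath2_ge_snd_eq:
  assumes "p \<in> bidisc" "snd p = snd q"
  shows "elog (cmod (snd q)) \<le> carath2 bidisc 0 p q"
  using assms carath2_ge_cayley_mean[of 0 "snd q" 1 1 p q] by (simp add: mem_bidisc)

text \<open>A Blaschke product of degree two in \<open>h\<close>. It is applied to a coordinate in
  which the optimal disc is a rotation, where the moduli of the values at the poles are |l| and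
  |m|.\<close>

lemma carath2_ge_Moebius_product:
  assumes h: "holomorphic2_on h bidisc" "\<And>v. v \<in> bidisc \<Longrightarrow> cmod (h v) < 1" "h 0 = 0"
    and pq: "p \<in> bidisc" "q \<in> bidisc"
  shows "elog (cmod (h p) * cmod (h q)) \<le> carath2 bidisc 0 p q"
proof -
  define F where "F = (\<lambda>v. Moebius_function 0 (h p) (h v) * Moebius_function 0 (h q) (h v))"
  have hp: "cmod (h p) < 1" "cmod (h q) < 1"
    using h pq by auto
  have "holomorphic2_on F bidisc"
    unfolding F_def using hp h
    by (intro holomorphic2_on_mult holomorphic2_on_compose[OF h(1), of _ "ball 0 1"]
        Moebius_function_holomorphic open_ball) auto
  moreover have "cmod (F v) < 1" if "v \<in> bidisc" for v
  proof -
    have "cmod (Moebius_function 0 (h p) (h v)) < 1" "cmod (Moebius_function 0 (h q) (h v)) < 1"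
      using Moebius_function_norm_lt_1 hp h(2)[OF that] by auto
    then show ?thesis unfolding F_def norm_mult
      using mult_strict_mono[of "cmod (Moebius_function 0 (h p) (h v))" 1 "cmod (Moebius_function 0 (h q) (h v))" 1]
      by simp
  qed
  moreover have "F p = 0" "F q = 0"
    by (auto simp: F_def Moebius_function_eq_zero)
  ultimately have "elog (cmod (F 0)) \<le> carath2 bidisc 0 p q"
    by (rule carath2_upper)
  then show ?thesis
    by (simp add: F_def h Moebius_function_of_zero norm_mult)
qed

subsection \<open>The Pick condition for discs through the origin\<close>

text \<open>Up to a positive factor, the determinant of the Pick matrix of \<open>l \<mapsto> x / l\<close>, \<open>m \<mapsto> y / m\<close>,
  multiplied out so that it also makes sense for nodes on the unit circle.\<close>

definition pick_gap :: "complex \<Rightarrow> complex \<Rightarrow> complex \<Rightarrow> complex \<Rightarrow> real" where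
  "pick_gap x y l m = ((cmod l)\<^sup>2 - (cmod x)\<^sup>2) * ((cmod m)\<^sup>2 - (cmod y)\<^sup>2) * (cmod (1 - l * cnj m))\<^sup>2
     - (1 - (cmod l)\<^sup>2) * (1 - (cmod m)\<^sup>2) * (cmod (l * cnj m - x * cnj y))\<^sup>2"

text \<open>Only closed conditions occur, so the admissible pairs form a compact set and |l m| has a
  minimum on it. For a node on the circle admissibility no longer produces an interpolating disc;
  such pairs serve as limits.\<close>

definition pick_admissible :: "complex \<Rightarrow> complex \<Rightarrow> complex \<Rightarrow> complex \<Rightarrow> bool" where
  "pick_admissible x y l m \<longleftrightarrow> cmod l \<le> 1 \<and> cmod m \<le> 1 \<and> cmod x \<le> cmod l \<and> cmod y \<le> cmod m \<and>
     0 \<le> pick_gap x y l m"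

lemma cmod_one_minus_mult_cnj_sq:
  "(cmod (1 - x * cnj y))\<^sup>2 = (1 - (cmod x)\<^sup>2) * (1 - (cmod y)\<^sup>2) + (cmod (x - y))\<^sup>2"
  unfolding cmod_power2 by (simp add: power2_eq_square algebra_simps)

text \<open>After division of the values by the nodes, a nonnegative gap is the Schwarz-Pick
  inequality: the pseudohyperbolic distance of \<open>X\<close> and \<open>Y\<close> is at most that
  of \<open>l\<close> and \<open>m\<close>.\<close>

lemma pick_gap_mult:
  "pick_gap (l * X) (m * Y) l m = (cmod l)\<^sup>2 * (cmod m)\<^sup>2 *
     ((cmod (1 - X * cnj Y))\<^sup>2 * (cmod (l - m))\<^sup>2 - (cmod (1 - l * cnj m))\<^sup>2 * (cmod (X - Y))\<^sup>2)"
proof -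
  have "l * cnj m - (l * X) * cnj (m * Y) = (l * cnj m) * (1 - X * cnj Y)"
    by (simp add: algebra_simps)
  then have "cmod (l * cnj m - (l * X) * cnj (m * Y)) = cmod l * cmod m * cmod (1 - X * cnj Y)"
    by (simp only: norm_mult complex_mod_cnj)
  then show ?thesis
    unfolding pick_gap_def norm_mult power_mult_distrib cmod_one_minus_mult_cnj_sq
    by (simp add: cmod_one_minus_mult_cnj_sq power_mult_distrib) (simp add: algebra_simps)
qed

lemma pick_admissible_imp_pseudohyperbolic:
  assumes "pick_admissible (l * X) (m * Y) l m" "l \<noteq> 0" "m \<noteq> 0"
  shows "cmod X \<le> 1" "cmod Y \<le> 1"
    "cmod (1 - l * cnj m) * cmod (X - Y) \<le> cmod (1 - X * cnj Y) * cmod (l - m)"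
proof -
  show "cmod X \<le> 1" "cmod Y \<le> 1"
    using assms by (auto simp: pick_admissible_def norm_mult)
  have "0 < (cmod l)\<^sup>2 * (cmod m)\<^sup>2" using assms by simp
  then have "(cmod (1 - l * cnj m) * cmod (X - Y))\<^sup>2 \<le> (cmod (1 - X * cnj Y) * cmod (l - m))\<^sup>2"
    using assms(1) unfolding pick_admissible_def pick_gap_mult
    by (simp add: zero_le_mult_iff power_mult_distrib)
  then show "cmod (1 - l * cnj m) * cmod (X - Y) \<le> cmod (1 - X * cnj Y) * cmod (l - m)"
    by (rule power2_le_imp_le) simp
qed

lemma cmod_diff_less_one_minus:
  assumes "cmod l < 1" "cmod m < 1"
  shows "cmod (l - m) < cmod (1 - l * cnj m)"
proof -
  have "(cmod l)\<^sup>2 < 1" "(cmod m)\<^sup>2 < 1"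
    using assms by (auto simp: abs_square_less_1)
  then have "(cmod (l - m))\<^sup>2 < (cmod (1 - l * cnj m))\<^sup>2"
    unfolding cmod_one_minus_mult_cnj_sq by simp
  then show ?thesis by (rule power2_less_imp_less) simp
qed

lemma cmod_one_minus_cnj_unimodular:
  assumes "cmod x = 1 \<or> cmod y = 1"
  shows "cmod (1 - x * cnj y) = cmod (x - y)"
proof -
  have "(cmod (1 - x * cnj y))\<^sup>2 = (cmod (x - y))\<^sup>2"
    using assms unfolding cmod_one_minus_mult_cnj_sq by auto
  then show ?thesis by simp
qed

text \<open>If one of \<open>X\<close>, \<open>Y\<close> is unimodular and they differ, their
  pseudohyperbolic quotient is 1, whereas that of \<open>l\<close> and \<open>m\<close> is below
  1.\<close>

lemma pick_admissible_unimodular: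
  assumes "pick_admissible (l * X) (m * Y) l m" "l \<noteq> 0" "m \<noteq> 0" "cmod l < 1" "cmod m < 1"
    and "cmod X = 1 \<or> cmod Y = 1"
  shows "X = Y"
proof (rule ccontr)
  assume "X \<noteq> Y"
  then have "cmod (X - Y) * cmod (l - m) < cmod (X - Y) * cmod (1 - l * cnj m)"
    using cmod_diff_less_one_minus[OF assms(4,5)] by (intro mult_strict_left_mono) auto
  then show False
    using pick_admissible_imp_pseudohyperbolic(3)[OF assms(1-3)] cmod_one_minus_cnj_unimodular[OF assms(6)]
    by (simp add: mult.commute)
qed

text \<open>One step of Schur's algorithm: f(t) = t h(t), where \<open>h\<close> is obtained from
  \<open>c * Moebius_function 0 l t\<close> by moving 0 to \<open>X\<close>. The Schwarz-Pick
  inequality says exactly that |c| \<le> 1; the degenerate case gives a constant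
  \<open>h\<close>.\<close>

lemma pick_interpolation:
  assumes adm: "pick_admissible x y l m"
    and lm: "cmod l < 1" "cmod m < 1" "l \<noteq> 0" "m \<noteq> 0" "l \<noteq> m"
  obtains f where "f holomorphic_on ball 0 1" "f ` ball 0 1 \<subseteq> ball 0 1" "f 0 = 0" "f l = x" "f m = y"
proof -
  define X where "X = x / l"
  define Y where "Y = y / m"
  have xy: "x = l * X" "y = m * Y" using lm by (auto simp: X_def Y_def)
  note ph = pick_admissible_imp_pseudohyperbolic[OF adm[unfolded xy] lm(3,4)]
  obtain h where h: "h holomorphic_on ball 0 1" "\<And>t. cmod t < 1 \<Longrightarrow> cmod (h t) \<le> 1" "h l = X" "h m = Y"
  proof (cases "cmod X = 1 \<or> cmod Y = 1")
    case True
    then have "X = Y"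
      using pick_admissible_unimodular[OF adm[unfolded xy]] lm by auto
    then show ?thesis using that[of "\<lambda>_. X"] ph by auto
  next
    case False
    with ph have XY: "cmod X < 1" "cmod Y < 1" by auto
    define c where "c = Moebius_function 0 X Y / Moebius_function 0 l m"
    have ne: "1 - cnj X * Y \<noteq> 0" "1 - cnj l * m \<noteq> 0"
      using one_minus_cnj_mult_nonzero XY lm by auto
    have sw: "cmod (1 - a * cnj b) = cmod (1 - cnj a * b)" for a b
      by (metis complex_cnj_cnj complex_cnj_diff complex_cnj_mult complex_cnj_one complex_mod_cnj)
    have Mlm: "Moebius_function 0 l m \<noteq> 0"
      using lm ne by (simp add: Moebius_function_simple)
    have "cmod (1 - cnj l * m) * cmod (Y - X) \<le> cmod (1 - cnj X * Y) * cmod (m - l)"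
      using ph(3) by (simp add: sw norm_minus_commute)
    then have c1: "cmod c \<le> 1"
      using ne lm unfolding c_def Moebius_function_simple norm_divide
      by (simp add: divide_simps mult.commute)
    define h where "h = (\<lambda>t. Moebius_function 0 (-X) (c * Moebius_function 0 l t))"
    have b: "cmod (c * Moebius_function 0 l t) < 1" if "cmod t < 1" for t
      using mult_right_mono[OF c1, of "cmod (Moebius_function 0 l t)"]
        Moebius_function_norm_lt_1[OF lm(1) that, of 0] by (simp add: norm_mult)
    have "(\<lambda>t. c * Moebius_function 0 l t) holomorphic_on ball 0 1"
      using Moebius_function_holomorphic[OF lm(1)] by (intro holomorphic_intros)
    moreover have "(\<lambda>t. c * Moebius_function 0 l t) ` ball 0 1 \<subseteq> ball 0 1"
      using b by (simp add: image_subset_iff)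
    ultimately have "h holomorphic_on ball 0 1"
      unfolding h_def using XY by (intro Moebius_function_holomorphic_compose) simp_all
    moreover have "cmod (h t) \<le> 1" if "cmod t < 1" for t
      unfolding h_def using Moebius_function_norm_lt_1[OF _ b[OF that], of "-X" 0] XY by simp
    moreover have "h l = X"
      by (simp add: h_def Moebius_function_eq_zero Moebius_function_of_zero)
    moreover have "h m = Y"
      using Mlm XY by (simp add: h_def c_def Moebius_function_cancel)
    ultimately show ?thesis by (rule that)
  qed
  have "(\<lambda>t. t * h t) holomorphic_on ball 0 1"
    using h by (intro holomorphic_intros)
  moreover have "cmod (t * h t) < 1" if "cmod t < 1" for t
    using mult_left_mono[OF h(2)[OF that], of "cmod t"] that by (simp add: norm_mult)
  ultimately show ?thesis
    using h xy by (intro that[of "\<lambda>t. t * h t"]) auto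
qed

lemma pick_admissible_same_node:
  assumes "pick_admissible x y l l" "l \<noteq> 0" "cmod l < 1"
  shows "x = y"
proof -
  have "pick_admissible (l * (x / l)) (l * (y / l)) l l" using assms by simp
  from pick_admissible_imp_pseudohyperbolic(3)[OF this assms(2,2)]
  have "cmod (1 - l * cnj l) * cmod (x / l - y / l) \<le> 0" by simp
  moreover have "1 - l * cnj l \<noteq> 0"
    using one_minus_cnj_mult_nonzero[of l l] assms by (simp add: mult.commute)
  ultimately have "x / l - y / l = 0"
    by (metis mult_le_0_iff norm_le_zero_iff)
  then show ?thesis using assms by simp
qed

lemma lempert2_le_admissible:
  assumes adm: "pick_admissible (fst p) (fst q) l m" "pick_admissible (snd p) (snd q) l m"
    and lm: "cmod l < 1" "cmod m < 1" "l \<noteq> 0" "m \<noteq> 0" and "p \<noteq> q"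
  shows "lempert2 bidisc 0 p q \<le> elog (cmod l * cmod m)"
proof -
  have ne: "l \<noteq> m"
    using pick_admissible_same_node adm lm \<open>p \<noteq> q\<close> by (metis prod_eqI)
  obtain f where f: "f holomorphic_on ball 0 1" "f ` ball 0 1 \<subseteq> ball 0 1" "f 0 = 0"
    "f l = fst p" "f m = fst q"
    using pick_interpolation[OF adm(1) lm ne] by blast
  obtain g where g: "g holomorphic_on ball 0 1" "g ` ball 0 1 \<subseteq> ball 0 1" "g 0 = 0"
    "g l = snd p" "g m = snd q"
    using pick_interpolation[OF adm(2) lm ne] by blast
  have "holomorphic_map2_on (\<lambda>t. (f t, g t)) (ball 0 1)" "(\<lambda>t. (f t, g t)) ` ball 0 1 \<subseteq> bidisc"
    using f g by (auto simp: holomorphic_map2_on_def bidisc_def)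
  then have "lempert2 bidisc 0 p q \<le> elog (cmod l) + elog (cmod m)"
    unfolding lempert2_def using f g lm
    by (intro Inf_lower CollectI exI[of _ l] exI[of _ m] exI[of _ "\<lambda>t. (f t, g t)"])
       (auto simp: zero_prod_def)
  then show ?thesis by (simp add: elog_mult)
qed

subsection \<open>First variation of the Pick condition\<close>

lemma has_real_derivative_cmod_sq:
  assumes "(g has_vector_derivative g') (at x)"
  shows "((\<lambda>e. (cmod (g e))\<^sup>2) has_real_derivative 2 * Re (cnj (g x) * g')) (at x)"
proof -
  have "(g has_derivative (\<lambda>h. h *\<^sub>R g')) (at x)"
    using assms by (simp add: has_vector_derivative_def)
  from has_derivative_inner[OF this this]
  have "((\<lambda>e. (cmod (g e))\<^sup>2) has_derivative (\<lambda>h. inner (g x) (h *\<^sub>R g') + inner (h *\<^sub>R g') (g x))) (at x)"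
    by (simp add: power2_norm_eq_inner)
  moreover have "(\<lambda>h. inner (g x) (h *\<^sub>R g') + inner (h *\<^sub>R g') (g x)) = (\<lambda>h. (2 * Re (cnj (g x) * g')) * h)"
    by (auto simp: inner_complex_def algebra_simps)
  ultimately show ?thesis by (simp add: has_field_derivative_def)
qed

text \<open>The derivative of \<open>pick_gap\<close> along a multiplicative perturbation of the
  nodes. In these coordinates the logarithmic derivative of |l m| is simply Re(u + v).\<close>

definition pick_gap_slope :: "complex \<Rightarrow> complex \<Rightarrow> complex \<Rightarrow> complex \<Rightarrow> complex \<Rightarrow> complex \<Rightarrow> real" where
  "pick_gap_slope x y l m u v =
     (2 * (cmod l)\<^sup>2 * Re u * ((cmod m)\<^sup>2 - (cmod y)\<^sup>2) + ((cmod l)\<^sup>2 - (cmod x)\<^sup>2) * (2 * (cmod m)\<^sup>2 * Re v))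
        * (cmod (1 - l * cnj m))\<^sup>2
     - ((cmod l)\<^sup>2 - (cmod x)\<^sup>2) * ((cmod m)\<^sup>2 - (cmod y)\<^sup>2)
        * (2 * Re (cnj (1 - l * cnj m) * (l * cnj m * (u + cnj v))))
     + (2 * (cmod l)\<^sup>2 * Re u * (1 - (cmod m)\<^sup>2) + (1 - (cmod l)\<^sup>2) * (2 * (cmod m)\<^sup>2 * Re v))
        * (cmod (l * cnj m - x * cnj y))\<^sup>2
     - (1 - (cmod l)\<^sup>2) * (1 - (cmod m)\<^sup>2)
        * (2 * Re (cnj (l * cnj m - x * cnj y) * (l * cnj m * (u + cnj v))))"

lemma cmod_sq_linear_has_derivative:
  "((\<lambda>e. (cmod (l * (1 + of_real e * u)))\<^sup>2) has_real_derivative 2 * (cmod l)\<^sup>2 * Re u) (at 0)"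
proof -
  have "((\<lambda>e. l * (1 + of_real e * u)) has_vector_derivative l * u) (at 0)"
    by (auto intro!: derivative_eq_intros)
  from has_real_derivative_cmod_sq[OF this]
  have "((\<lambda>e. (cmod (l * (1 + of_real e * u)))\<^sup>2) has_real_derivative 2 * Re (cnj l * (l * u))) (at 0)"
    by simp
  moreover have "2 * Re (cnj l * (l * u)) = 2 * (cmod l)\<^sup>2 * Re u"
    unfolding cmod_power2 by (simp add: power2_eq_square algebra_simps)
  ultimately show ?thesis by (simp only:)
qed

lemma pick_gap_has_derivative:
  "((\<lambda>e. pick_gap x y (l * (1 + of_real e * u)) (m * (1 + of_real e * v)))
     has_real_derivative pick_gap_slope x y l m u v) (at 0)"
proof -
  define L where "L = (\<lambda>e::real. l * (1 + of_real e * u))"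
  define M where "M = (\<lambda>e::real. m * (1 + of_real e * v))"
  have cM: "cnj (M e) = cnj m * (1 + of_real e * cnj v)" for e
    by (simp add: M_def)
  have [simp]: "L 0 = l" "M 0 = m" by (auto simp: L_def M_def)
  have dL: "((\<lambda>e. (cmod (L e))\<^sup>2) has_real_derivative 2 * (cmod l)\<^sup>2 * Re u) (at 0)"
    unfolding L_def by (rule cmod_sq_linear_has_derivative)
  have dM: "((\<lambda>e. (cmod (M e))\<^sup>2) has_real_derivative 2 * (cmod m)\<^sup>2 * Re v) (at 0)"
    unfolding M_def by (rule cmod_sq_linear_has_derivative)
  have LM: "((\<lambda>e. L e * cnj (M e)) has_vector_derivative l * cnj m * (u + cnj v)) (at 0)"
    unfolding cM unfolding L_def by (auto intro!: derivative_eq_intros simp: algebra_simps)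
  define r1 where "r1 = - Re (cnj (1 - l * cnj m) * (l * cnj m * (u + cnj v)))"
  define r2 where "r2 = Re (cnj (l * cnj m - x * cnj y) * (l * cnj m * (u + cnj v)))"
  have r1_neg: "Re (cnj (1 - l * cnj m) * (l * cnj m * (u + cnj v))) = - r1"
    by (simp add: r1_def)
  have d1: "((\<lambda>e. (cmod (1 - L e * cnj (M e)))\<^sup>2) has_real_derivative 2 * r1) (at 0)"
    using has_real_derivative_cmod_sq[OF has_vector_derivative_diff[OF has_vector_derivative_const[of 1] LM]]
    by (simp add: r1_def)
  have d2: "((\<lambda>e. (cmod (L e * cnj (M e) - x * cnj y))\<^sup>2) has_real_derivative 2 * r2) (at 0)"
    using has_real_derivative_cmod_sq[OF has_vector_derivative_diff[OF LM has_vector_derivative_const[of "x * cnj y"]]]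
    by (simp add: r2_def)
  have "((\<lambda>e. pick_gap x y (L e) (M e)) has_real_derivative pick_gap_slope x y l m u v) (at 0)"
    unfolding pick_gap_def
    by (rule DERIV_cong[OF DERIV_diff[OF DERIV_mult[OF DERIV_mult[OF DERIV_diff[OF dL DERIV_const] DERIV_diff[OF dM DERIV_const]] d1]
           DERIV_mult[OF DERIV_mult[OF DERIV_diff[OF DERIV_const dL] DERIV_diff[OF DERIV_const dM]] d2]]])
       (simp only: pick_gap_slope_def r2_def[symmetric] r1_neg \<open>L 0 = l\<close> \<open>M 0 = m\<close>,
        simp add: algebra_simps)
  then show ?thesis by (simp add: L_def M_def)
qed

lemma eventually_pick_gap_pos:
  assumes "pick_gap x y l m > 0 \<or> pick_gap x y l m = 0 \<and> pick_gap_slope x y l m u v > 0"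
  shows "eventually (\<lambda>e. pick_gap x y (l * (1 + of_real e * u)) (m * (1 + of_real e * v)) > 0) (at_right 0)"
proof -
  define f where "f = (\<lambda>e::real. pick_gap x y (l * (1 + of_real e * u)) (m * (1 + of_real e * v)))"
  have f: "(f has_real_derivative pick_gap_slope x y l m u v) (at 0)"
    unfolding f_def by (rule pick_gap_has_derivative)
  have f0: "f 0 = pick_gap x y l m" by (simp add: f_def)
  have "eventually (\<lambda>e. f e > 0) (at_right 0)"
    using assms
  proof
    assume "pick_gap x y l m > 0"
    moreover have "(f \<longlongrightarrow> f 0) (at_right 0)"
      using DERIV_isCont[OF f] by (simp add: isCont_def filterlim_at_split)
    ultimately show ?thesis by (simp add: f0 order_tendstoD(1))
  next
    assume "pick_gap x y l m = 0 \<and> pick_gap_slope x y l m u v > 0"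
    then obtain d where "d > 0" "\<And>h. h > 0 \<Longrightarrow> h < d \<Longrightarrow> f 0 < f (0 + h)"
      using DERIV_pos_inc_right[OF f] by blast
    then show ?thesis
      unfolding eventually_at_right_field using f0 \<open>_ \<and> _\<close> by (intro exI[of _ d]) auto
  qed
  then show ?thesis by (simp add: f_def)
qed

lemma eventually_cmod_linear:
  assumes "cmod l < r"
  shows "eventually (\<lambda>e. cmod (l * (1 + of_real e * u)) < r) (at_right 0)"
proof -
  have "((\<lambda>e::real. cmod (l * (1 + of_real e * u))) \<longlongrightarrow> cmod (l * (1 + of_real 0 * u))) (at_right 0)"
    by (intro tendsto_intros)
  then show ?thesis using assms by (intro order_tendstoD(2)) auto
qed

lemma eventually_cmod_linear_gt:
  assumes "r < cmod l"
  shows "eventually (\<lambda>e. r < cmod (l * (1 + of_real e * u))) (at_right 0)"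
proof -
  have "((\<lambda>e::real. cmod (l * (1 + of_real e * u))) \<longlongrightarrow> cmod (l * (1 + of_real 0 * u))) (at_right 0)"
    by (intro tendsto_intros)
  then show ?thesis using assms by (intro order_tendstoD(1)) auto
qed

lemma eventually_pick_admissible:
  assumes "cmod x < cmod l" "cmod y < cmod m" "cmod l < 1" "cmod m < 1"
    and "pick_gap x y l m > 0 \<or> pick_gap x y l m = 0 \<and> pick_gap_slope x y l m u v > 0"
  shows "eventually (\<lambda>e. pick_admissible x y (l * (1 + of_real e * u)) (m * (1 + of_real e * v))) (at_right 0)"
  using eventually_cmod_linear[OF assms(3), of u] eventually_cmod_linear[OF assms(4), of v]
    eventually_cmod_linear_gt[OF assms(1), of u] eventually_cmod_linear_gt[OF assms(2), of v]
    eventually_pick_gap_pos[OF assms(5)]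
  by eventually_elim (auto simp: pick_admissible_def)

lemma eventually_cmod_mult_less:
  assumes "l \<noteq> 0" "m \<noteq> 0" "Re (u + v) < 0"
  shows "eventually (\<lambda>e. cmod (l * (1 + of_real e * u)) * cmod (m * (1 + of_real e * v)) < cmod l * cmod m) (at_right 0)"
proof -
  define f where "f = (\<lambda>e::real. (cmod (l * (1 + of_real e * u)))\<^sup>2 * (cmod (m * (1 + of_real e * v)))\<^sup>2)"
  have "(f has_real_derivative 2 * (cmod l)\<^sup>2 * Re u * (cmod m)\<^sup>2 + 2 * (cmod m)\<^sup>2 * Re v * (cmod l)\<^sup>2) (at 0)"
    unfolding f_def
    using DERIV_mult[OF cmod_sq_linear_has_derivative[of l u] cmod_sq_linear_has_derivative[of m v]]
    by simp
  moreover have "2 * (cmod l)\<^sup>2 * Re u * (cmod m)\<^sup>2 + 2 * (cmod m)\<^sup>2 * Re v * (cmod l)\<^sup>2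
      = 2 * (cmod l)\<^sup>2 * (cmod m)\<^sup>2 * Re (u + v)"
    by (simp add: algebra_simps)
  ultimately have D: "(f has_real_derivative 2 * (cmod l)\<^sup>2 * (cmod m)\<^sup>2 * Re (u + v)) (at 0)"
    by simp
  have "2 * (cmod l)\<^sup>2 * (cmod m)\<^sup>2 * Re (u + v) < 0"
    using assms by (intro mult_pos_neg) auto
  from DERIV_neg_dec_right[OF D this]
  obtain d where d: "d > 0" "\<And>h. h > 0 \<Longrightarrow> h < d \<Longrightarrow> f (0 + h) < f 0" by blast
  have "cmod (l * (1 + of_real e * u)) * cmod (m * (1 + of_real e * v)) < cmod l * cmod m" if "0 < e" "e < d" for e
  proof -
    have "f e < f 0" using d(2)[OF that] by simp
    then have "(cmod (l * (1 + of_real e * u)) * cmod (m * (1 + of_real e * v)))\<^sup>2 < (cmod l * cmod m)\<^sup>2"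
      by (simp add: f_def power_mult_distrib)
    then show ?thesis by (rule power2_less_imp_less) simp
  qed
  then show ?thesis
    unfolding eventually_at_right_field using d(1) by (intro exI[of _ d]) auto
qed

subsection \<open>Extremal interpolation data\<close>

text \<open>The equality case of Schwarz-Pick: the Schur constant \<open>c\<close> is unimodular, so
  the interpolating function is an automorphism of the disc, and its zero and its rotation are
  computed explicitly.\<close>

lemma pick_gap_eq_0_imp_automorphism:
  assumes gap: "pick_gap (l * X) (m * Y) l m = 0"
    and lm: "l \<noteq> 0" "m \<noteq> 0" "l \<noteq> m" "cmod l < 1" "cmod m < 1" and XY: "cmod X < 1" "cmod Y < 1"
  obtains a h where "cmod a < 1" "cmod h = 1"
    "X = h * (l - a) / (1 - cnj a * l)" "Y = h * (m - a) / (1 - cnj a * m)"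
proof -
  have "(cmod (1 - X * cnj Y) * cmod (l - m))\<^sup>2 = (cmod (1 - l * cnj m) * cmod (X - Y))\<^sup>2"
    using gap lm unfolding pick_gap_mult by (simp add: power_mult_distrib)
  then have eq: "cmod (1 - X * cnj Y) * cmod (l - m) = cmod (1 - l * cnj m) * cmod (X - Y)"
    by simp
  have sw: "cmod (1 - a * cnj b) = cmod (1 - cnj a * b)" for a b
    by (metis complex_cnj_cnj complex_cnj_diff complex_cnj_mult complex_cnj_one complex_mod_cnj)
  have ne: "1 - cnj X * Y \<noteq> 0" "1 - cnj l * m \<noteq> 0" "1 - cnj l * l \<noteq> 0" "m - l \<noteq> 0"
    using one_minus_cnj_mult_nonzero XY lm by auto
  define c where "c = ((Y - X) * (1 - cnj l * m)) / ((1 - cnj X * Y) * (m - l))"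
  have "cmod (Y - X) * cmod (1 - cnj l * m) = cmod (1 - cnj X * Y) * cmod (m - l)"
    using eq unfolding sw norm_minus_commute[of Y X] norm_minus_commute[of m l] by (simp only: mult.commute)
  moreover have "cmod (1 - cnj X * Y) * cmod (m - l) \<noteq> 0"
    using ne by simp
  ultimately have "cmod c = 1"
    unfolding c_def norm_divide norm_mult by simp
  then have cc: "c * cnj c = 1"
    by (metis complex_norm_square of_real_1 one_power2)
  then have c0: "c \<noteq> 0" by auto
  \<comment> \<open>The automorphism z -> M_(-X)(c M_l(z)), with M_a =
    \<open>Moebius_function 0 a\<close>, has the numerator \<open>A * z - B\<close>; hence its zero
    is B/A, which lies in the disc because |B| < |A|.\<close>
  define A where "A = c - X * cnj l"
  define B where "B = c * l - X"
  have "cmod A = cmod (1 - l * cnj (cnj c * X))"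
  proof -
    have "A = c * cnj (1 - l * cnj (cnj c * X))"
      using cc by (simp add: A_def algebra_simps)
    then have "cmod A = cmod c * cmod (1 - l * cnj (cnj c * X))"
      by (metis complex_mod_cnj norm_mult)
    then show ?thesis using \<open>cmod c = 1\<close> by simp
  qed
  moreover have "cmod B = cmod (l - cnj c * X)"
  proof -
    have "B = c * (l - cnj c * X)"
      using cc by (simp add: B_def algebra_simps)
    then show ?thesis using \<open>cmod c = 1\<close> by (simp add: norm_mult)
  qed
  moreover have "cmod (l - cnj c * X) < cmod (1 - l * cnj (cnj c * X))"
    using cmod_diff_less_one_minus[of l "cnj c * X"] lm XY \<open>cmod c = 1\<close> by (simp add: norm_mult)
  ultimately have BA: "cmod B < cmod A" by simp
  then have A0: "A \<noteq> 0" by auto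
  define a where "a = B / A"
  define h where "h = A / (c * cnj A)"
  have a1: "cmod a < 1" using BA A0 by (simp add: a_def norm_divide)
  have h1: "cmod h = 1" using A0 \<open>cmod c = 1\<close> by (simp add: h_def norm_divide norm_mult)
  have form: "h * (z - a) / (1 - cnj a * z) = (A * z - B) / (c * (cnj A - cnj B * z))" for z
  proof -
    have "z - a = (A * z - B) / A"
      using A0 by (simp add: a_def field_simps)
    then have "h * (z - a) = (A * z - B) / (c * cnj A)"
      using A0 by (simp add: h_def)
    moreover have "1 - cnj a * z = (cnj A - cnj B * z) / cnj A"
      using A0 by (simp add: a_def field_simps)
    ultimately show ?thesis using A0 c0 by simp
  qed
  have den: "c * (cnj A - cnj B * z) = (1 - cnj l * z) + c * cnj X * (z - l)" for z
  proof -
    have "c * (cnj A - cnj B * z) = c * cnj c * (1 - cnj l * z) + c * cnj X * (z - l)"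
      by (simp add: A_def B_def algebra_simps)
    then show ?thesis by (simp add: cc)
  qed
  have num: "A * z - B = c * (z - l) + X * (1 - cnj l * z)" for z
    by (simp add: A_def B_def algebra_simps)
  have "X = h * (l - a) / (1 - cnj a * l)"
    unfolding form den num using ne by simp
  moreover have "Y = h * (m - a) / (1 - cnj a * m)"
  proof -
    have cm: "c * (m - l) = (Y - X) * (1 - cnj l * m) / (1 - cnj X * Y)"
      using ne by (simp add: c_def)
    have xx: "1 - cnj X * X \<noteq> 0" using one_minus_cnj_mult_nonzero XY by auto
    have "c * (m - l) + X * (1 - cnj l * m) = (1 - cnj l * m) * Y * (1 - cnj X * X) / (1 - cnj X * Y)"
      unfolding cm using ne by (simp add: field_simps)
    moreover have "(1 - cnj l * m) + c * cnj X * (m - l) = (1 - cnj l * m) * (1 - cnj X * X) / (1 - cnj X * Y)"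
    proof -
      have "c * cnj X * (m - l) = cnj X * (c * (m - l))" by simp
      then show ?thesis unfolding cm using ne by (simp add: field_simps)
    qed
    ultimately show ?thesis
      unfolding form den num using ne xx by simp
  qed
  ultimately show ?thesis using that a1 h1 by blast
qed

text \<open>Up to a positive factor, \<open>critical_form a z\<close> is \<open>(z - c) * (1 - cnj c * z)\<close>, where \<open>c\<close> is the
  critical point of \<open>\<lambda>t. t * (t - a) / (1 - cnj a * t)\<close> in the disc. The point of this normalisation is that it
  is real affine in \<open>a\<close>.\<close>

definition critical_form :: "complex \<Rightarrow> complex \<Rightarrow> complex" where
  "critical_form a z = 2 * z - cnj a * z\<^sup>2 - a"

text \<open>Equal to \<open>cnj l / (1 - l * cnj l) - cnj m / (1 - l * cnj m)\<close>, the Wirtinger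
  derivative in \<open>l\<close> of -log(1 - \<rho>^2), where \<rho> is the pseudohyperbolic
  distance of \<open>l\<close> and \<open>m\<close>.\<close>

definition node_weight :: "complex \<Rightarrow> complex \<Rightarrow> complex" where
  "node_weight l m = (cnj l - cnj m) / ((1 - l * cnj l) * (1 - l * cnj m))"

lemma automorphism_one_minus_mult_cnj:
  assumes "cmod h = 1" "cmod a < 1" "cmod l < 1" "cmod m < 1"
  shows "1 - (h * (l - a) / (1 - cnj a * l)) * cnj (h * (m - a) / (1 - cnj a * m))
    = (1 - a * cnj a) * (1 - l * cnj m) / ((1 - cnj a * l) * (1 - a * cnj m))"
proof -
  have hh: "h * cnj h = 1"
    using assms by (metis complex_norm_square of_real_1 one_power2)
  have ne: "1 - cnj a * l \<noteq> 0" "1 - a * cnj m \<noteq> 0"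
    using one_minus_cnj_mult_nonzero[of a l] one_minus_cnj_mult_nonzero[of m a] assms by (auto simp: mult.commute)
  have "(h * (l - a) / (1 - cnj a * l)) * cnj (h * (m - a) / (1 - cnj a * m))
    = (h * cnj h) * ((l - a) * (cnj m - cnj a)) / ((1 - cnj a * l) * (1 - a * cnj m))"
    by (simp add: mult_ac)
  also have "\<dots> = ((l - a) * (cnj m - cnj a)) / ((1 - cnj a * l) * (1 - a * cnj m))"
    by (simp add: hh)
  finally show ?thesis
    using ne by (simp only:) (simp add: divide_simps, simp add: algebra_simps)
qed

text \<open>The primed variables stand for conjugates. Treated as independent, they turn the claim
  into a polynomial identity over a common denominator.\<close>

lemma slope_coefficient_identity:
  fixes a a' l l' m' :: complex
  assumes "1 - a * a' \<noteq> 0" "1 - l * l' \<noteq> 0" "1 - l * m' \<noteq> 0"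
  shows "(1 - a' * l) * (1 - a * l') / ((1 - a * a') * (1 - l * l')) + l * l' / (1 - l * l')
     - l * m' / (1 - l * m') - (1 - a' * l) * (1 - a * m') / ((1 - a * a') * (1 - l * m'))
     = (2 * l - a' * l\<^sup>2 - a) * ((l' - m') / ((1 - l * l') * (1 - l * m'))) / (1 - a * a')"
proof -
  have "(1 - a' * l) * (1 - a * l') / ((1 - a * a') * (1 - l * l'))
      = (1 - a' * l) * (1 - a * l') * (1 - l * m') / ((1 - a * a') * (1 - l * l') * (1 - l * m'))"
    "l * l' / (1 - l * l') = l * l' * (1 - a * a') * (1 - l * m') / ((1 - a * a') * (1 - l * l') * (1 - l * m'))"
    "l * m' / (1 - l * m') = l * m' * (1 - a * a') * (1 - l * l') / ((1 - a * a') * (1 - l * l') * (1 - l * m'))"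
    "(1 - a' * l) * (1 - a * m') / ((1 - a * a') * (1 - l * m'))
      = (1 - a' * l) * (1 - a * m') * (1 - l * l') / ((1 - a * a') * (1 - l * l') * (1 - l * m'))"
    "(2 * l - a' * l\<^sup>2 - a) * ((l' - m') / ((1 - l * l') * (1 - l * m'))) / (1 - a * a')
      = (2 * l - a' * l\<^sup>2 - a) * (l' - m') / ((1 - a * a') * (1 - l * l') * (1 - l * m'))"
    using assms by (simp_all add: mult_ac)
  moreover have "(1 - a' * l) * (1 - a * l') * (1 - l * m') + l * l' * (1 - a * a') * (1 - l * m')
     - l * m' * (1 - a * a') * (1 - l * l') - (1 - a' * l) * (1 - a * m') * (1 - l * l')
     = (2 * l - a' * l\<^sup>2 - a) * (l' - m')"
    by (simp add: algebra_simps power2_eq_square)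
  ultimately show ?thesis
    by (simp only: add_divide_distrib[symmetric] diff_divide_distrib[symmetric])
qed

text \<open>The gap is a difference of two products, which agree when it vanishes. Its derivative is
  then their common value times the difference of their logarithmic derivatives, and the form of the
  automorphism turns these into \<open>critical_form\<close>.\<close>

lemma pick_gap_slope_automorphism:
  assumes X: "X = h * (l - a) / (1 - cnj a * l)" and Y: "Y = h * (m - a) / (1 - cnj a * m)"
    and h: "cmod h = 1" and a: "cmod a < 1"
    and lm: "l \<noteq> 0" "m \<noteq> 0" "cmod l < 1" "cmod m < 1"
    and gap: "pick_gap (l * X) (m * Y) l m = 0" and XY: "cmod X < 1" "cmod Y < 1"
  obtains V where "V > 0"
    "pick_gap_slope (l * X) (m * Y) l m u v
      = V * Re (u * node_weight l m * critical_form a l + v * node_weight m l * critical_form a m)"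
proof -
  define P where "P = l * cnj m"
  define Q where "Q = 1 - X * cnj Y"
  define V where "V = ((cmod l)\<^sup>2 - (cmod (l * X))\<^sup>2) * ((cmod m)\<^sup>2 - (cmod (m * Y))\<^sup>2) * (cmod (1 - P))\<^sup>2"
  define x1 where "x1 = 1 - (cmod X)\<^sup>2"
  define y1 where "y1 = 1 - (cmod Y)\<^sup>2"
  define l1 where "l1 = 1 - (cmod l)\<^sup>2"
  define m1 where "m1 = 1 - (cmod m)\<^sup>2"
  have pos: "x1 > 0" "y1 > 0" "l1 > 0" "m1 > 0" "(cmod l)\<^sup>2 > 0" "(cmod m)\<^sup>2 > 0"
    using XY lm by (auto simp: x1_def y1_def l1_def m1_def abs_square_less_1)
  have A: "(cmod l)\<^sup>2 - (cmod (l * X))\<^sup>2 = (cmod l)\<^sup>2 * x1" "(cmod m)\<^sup>2 - (cmod (m * Y))\<^sup>2 = (cmod m)\<^sup>2 * y1"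
    by (auto simp: x1_def y1_def norm_mult power_mult_distrib algebra_simps)
  have P1: "1 - P \<noteq> 0"
    using one_minus_cnj_mult_nonzero[of m l] lm by (simp add: P_def mult.commute)
  have Q0: "Q \<noteq> 0"
    using one_minus_cnj_mult_nonzero[of Y X] XY by (simp add: Q_def mult.commute)
  have E: "l * cnj m - (l * X) * cnj (m * Y) = P * Q"
    by (simp add: P_def Q_def algebra_simps)
  have V: "V = (cmod l)\<^sup>2 * x1 * ((cmod m)\<^sup>2 * y1) * (cmod (1 - P))\<^sup>2"
    unfolding V_def A ..
  have Vpos: "V > 0" unfolding V using pos P1 by simp
  have V2: "V = l1 * m1 * (cmod (P * Q))\<^sup>2"
    using gap unfolding pick_gap_def E V_def l1_def m1_def by (simp add: P_def)
  define s where "s = u + cnj v"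
  have t1: "2 * (cmod l)\<^sup>2 * Re u * ((cmod m)\<^sup>2 * y1) * (cmod (1 - P))\<^sup>2 = 2 * V * (Re u / x1)"
    unfolding V using pos by simp
  have t2: "(cmod l)\<^sup>2 * x1 * (2 * (cmod m)\<^sup>2 * Re v) * (cmod (1 - P))\<^sup>2 = 2 * V * (Re v / y1)"
    unfolding V using pos by simp
  have cdiv: "Re (cnj z * w) = (cmod z)\<^sup>2 * Re (w / z)" if "z \<noteq> 0" for z w
  proof -
    have "cnj z * w = of_real ((cmod z)\<^sup>2) * (w / z)"
      using that by (simp add: complex_norm_square del: of_real_power)
    then show ?thesis by (simp only: Re_complex_of_real times_complex.sel Im_complex_of_real)
  qed
  have t3: "(cmod l)\<^sup>2 * x1 * ((cmod m)\<^sup>2 * y1) * (2 * Re (cnj (1 - P) * (P * s))) = 2 * V * Re (P * s / (1 - P))"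
    unfolding cdiv[OF P1] V by simp
  have t4: "2 * (cmod l)\<^sup>2 * Re u * m1 * (cmod (P * Q))\<^sup>2 = 2 * V * ((cmod l)\<^sup>2 * Re u / l1)"
    unfolding V2 using pos by simp
  have t5: "l1 * (2 * (cmod m)\<^sup>2 * Re v) * (cmod (P * Q))\<^sup>2 = 2 * V * ((cmod m)\<^sup>2 * Re v / m1)"
    unfolding V2 using pos by simp
  have P0: "P \<noteq> 0" using lm by (simp add: P_def)
  then have PQ: "P * Q \<noteq> 0" using Q0 by simp
  have t6: "l1 * m1 * (2 * Re (cnj (P * Q) * (P * s))) = 2 * V * Re (s / Q)"
    unfolding cdiv[OF PQ] V2 using P0 by simp
  have slope: "pick_gap_slope (l * X) (m * Y) l m u v = 2 * V * (Re u / x1 + Re v / y1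
      - Re (P * s / (1 - P)) + (cmod l)\<^sup>2 * Re u / l1 + (cmod m)\<^sup>2 * Re v / m1 - Re (s / Q))"
  proof -
    have "2 * V * k1 + 2 * V * k2 - 2 * V * k3 + (2 * V * k4 + 2 * V * k5) - 2 * V * k6
      = 2 * V * (k1 + k2 - k3 + k4 + k5 - k6)" for k1 k2 k3 k4 k5 k6
      by (simp add: algebra_simps)
    then show ?thesis
      unfolding pick_gap_slope_def A E
      unfolding P_def[symmetric] s_def[symmetric] l1_def[symmetric] m1_def[symmetric]
      unfolding distrib_right t1 t2 t3 t4 t5 t6 .
  qed
  \<comment> \<open>\<open>K\<close> and \<open>K'\<close> are the coefficients of \<open>u\<close>
    and \<open>v\<close>. Terms containing \<open>cnj v\<close> are conjugated inside the real part,
    which is why \<open>K'\<close> carries \<open>cnj P\<close> and \<open>cnj Q\<close>.\<close>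
  define K where "K = 1 / of_real x1 + of_real ((cmod l)\<^sup>2) / of_real l1 - P / (1 - P) - 1 / Q"
  define K' where "K' = 1 / of_real y1 + of_real ((cmod m)\<^sup>2) / of_real m1 - cnj P / (1 - cnj P) - 1 / cnj Q"
  have "Re u / x1 + Re v / y1
      - Re (P * s / (1 - P)) + (cmod l)\<^sup>2 * Re u / l1 + (cmod m)\<^sup>2 * Re v / m1 - Re (s / Q)
     = Re (u * K + v * K')"
  proof -
    have "Re (P * s / (1 - P)) = Re (P * u / (1 - P)) + Re (P * cnj v / (1 - P))"
      by (simp add: s_def algebra_simps add_divide_distrib)
    also have "Re (P * cnj v / (1 - P)) = Re (cnj (P * cnj v / (1 - P)))" by (simp only: cnj.sel)
    also have "cnj (P * cnj v / (1 - P)) = v * (cnj P / (1 - cnj P))" by simp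
    finally have e1: "Re (P * s / (1 - P)) = Re (u * (P / (1 - P))) + Re (v * (cnj P / (1 - cnj P)))"
      by (simp add: mult.commute)
    have "Re (s / Q) = Re (u / Q) + Re (cnj v / Q)"
      by (simp add: s_def add_divide_distrib)
    also have "Re (cnj v / Q) = Re (cnj (cnj v / Q))" by (simp only: cnj.sel)
    finally have e2: "Re (s / Q) = Re (u * (1 / Q)) + Re (v * (1 / cnj Q))" by simp
    have er: "Re (w * (of_real c / of_real d)) = c * Re w / d" for w c d
      by (simp flip: of_real_divide)
    have e3: "Re (u * (1 / of_real x1)) = Re u / x1" "Re (v * (1 / of_real y1)) = Re v / y1"
      "Re (u * (of_real ((cmod l)\<^sup>2) / of_real l1)) = (cmod l)\<^sup>2 * Re u / l1"
      "Re (v * (of_real ((cmod m)\<^sup>2) / of_real m1)) = (cmod m)\<^sup>2 * Re v / m1"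
      using er[of u 1 x1] er[of v 1 y1] er[of u "(cmod l)\<^sup>2" l1] er[of v "(cmod m)\<^sup>2" m1] by simp_all
    show ?thesis
      unfolding K_def K'_def e1 e2 right_diff_distrib distrib_left
      by (simp only: plus_complex.sel minus_complex.sel e3)
  qed
  moreover have "K = critical_form a l * node_weight l m / (1 - a * cnj a)"
    "K' = critical_form a m * node_weight m l / (1 - a * cnj a)"
  proof -
    have ne: "1 - a * cnj a \<noteq> 0" "1 - l * cnj l \<noteq> 0" "1 - m * cnj m \<noteq> 0" "1 - l * cnj m \<noteq> 0" "1 - m * cnj l \<noteq> 0"
      using one_minus_cnj_mult_nonzero[of a a] one_minus_cnj_mult_nonzero[of l l] one_minus_cnj_mult_nonzero[of m m]
        one_minus_cnj_mult_nonzero[of l m] one_minus_cnj_mult_nonzero[of m l] a lm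
      by (auto simp: mult.commute)
    have xx: "of_real x1 = 1 - X * cnj X" "of_real y1 = 1 - Y * cnj Y"
      "of_real l1 = 1 - l * cnj l" "of_real m1 = 1 - m * cnj m" "cnj Q = 1 - Y * cnj X" "cnj P = m * cnj l"
      by (simp_all add: x1_def y1_def l1_def m1_def Q_def P_def complex_norm_square[symmetric] mult.commute)
    show "K = critical_form a l * node_weight l m / (1 - a * cnj a)"
      unfolding K_def xx Q_def P_def X Y automorphism_one_minus_mult_cnj[OF h a lm(3) lm(3)]
        automorphism_one_minus_mult_cnj[OF h a lm(3) lm(4)] complex_norm_square critical_form_def node_weight_def
      using slope_coefficient_identity[of a "cnj a" l "cnj l" "cnj m"] ne by simp
    show "K' = critical_form a m * node_weight m l / (1 - a * cnj a)"
      unfolding K'_def xx X Y automorphism_one_minus_mult_cnj[OF h a lm(4) lm(4)]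
        automorphism_one_minus_mult_cnj[OF h a lm(4) lm(3)] complex_norm_square critical_form_def node_weight_def
      using slope_coefficient_identity[of a "cnj a" m "cnj m" "cnj l"] ne by simp
  qed
  ultimately have "pick_gap_slope (l * X) (m * Y) l m u v =
     2 * V * Re ((u * node_weight l m * critical_form a l + v * node_weight m l * critical_form a m) / (1 - a * cnj a))"
    using slope by (simp add: add_divide_distrib mult_ac)
  also have "1 - a * cnj a = of_real (1 - (cmod a)\<^sup>2)"
    by (simp add: complex_norm_square[symmetric])
  finally have "pick_gap_slope (l * X) (m * Y) l m u v = 2 * V / (1 - (cmod a)\<^sup>2) *
     Re (u * node_weight l m * critical_form a l + v * node_weight m l * critical_form a m)"
    by (simp del: of_real_diff)
  moreover have "2 * V / (1 - (cmod a)\<^sup>2) > 0"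
    using Vpos a by (simp add: abs_square_less_1)
  ultimately show ?thesis using that by blast
qed

text \<open>The zero \<open>b\<close> for which \<open>\<lambda>t. t * (t - b) / (1 - cnj b * t)\<close> takes the same value at \<open>l\<close> and \<open>m\<close>;
  that value is \<open>- l * m\<close>.\<close>

definition exchange_point :: "complex \<Rightarrow> complex \<Rightarrow> complex" where
  "exchange_point l m = (l + m - l * m * cnj (l + m)) / (1 - l * m * cnj (l * m))"

lemma cmod_mult_less_one:
  assumes "cmod l < 1" "cmod m < 1"
  shows "cmod (l * m) < 1"
  using mult_strict_mono[of "cmod l" 1 "cmod m" 1] assms by (simp add: norm_mult)

lemma one_minus_mult_cnj_nonzero:
  assumes "cmod x < 1" "cmod y < 1"
  shows "1 - x * cnj y \<noteq> 0"
  using one_minus_cnj_mult_nonzero[of y x] assms by (simp add: mult.commute)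

lemma exchange_point_commute: "exchange_point l m = exchange_point m l"
  by (simp add: exchange_point_def add.commute mult.commute)

text \<open>The equation z(z - b) = -lm(1 - cnj b z) is a monic quadratic with constant term lm. Its
  roots are \<open>l\<close> and \<open>m\<close> exactly when
  \<open>b + l * m * cnj b = l + m\<close>; solving this together with its conjugate gives the
  formula for \<open>b\<close>.\<close>

lemma exchange_point_eq:
  assumes "cmod l < 1" "cmod m < 1"
  shows "exchange_point l m + l * m * cnj (exchange_point l m) = l + m"
proof -
  define N where "N = 1 - l * m * cnj (l * m)"
  have N: "N \<noteq> 0" unfolding N_def
    by (intro one_minus_mult_cnj_nonzero cmod_mult_less_one assms)
  have b: "exchange_point l m = (l + m - l * m * cnj (l + m)) / N"
    by (simp add: exchange_point_def N_def)
  have cN: "cnj N = N" by (simp add: N_def mult.commute)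
  have "exchange_point l m + l * m * cnj (exchange_point l m)
     = ((l + m - l * m * cnj (l + m)) + l * m * cnj (l + m - l * m * cnj (l + m))) / N"
    unfolding b complex_cnj_divide cN by (simp add: add_divide_distrib)
  also have "(l + m - l * m * cnj (l + m)) + l * m * cnj (l + m - l * m * cnj (l + m)) = (l + m) * N"
    by (simp add: N_def algebra_simps)
  finally show ?thesis using N by simp
qed

lemma exchange_point_root:
  assumes "cmod l < 1" "cmod m < 1"
  shows "l * (l - exchange_point l m) = - (l * m) * (1 - cnj (exchange_point l m) * l)"
    and "m * (m - exchange_point l m) = - (l * m) * (1 - cnj (exchange_point l m) * m)"
proof -
  have b: "exchange_point l m = l + m - l * m * cnj (exchange_point l m)"
    using exchange_point_eq[OF assms] by (simp add: algebra_simps)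
  show "l * (l - exchange_point l m) = - (l * m) * (1 - cnj (exchange_point l m) * l)"
    by (subst (1) b) (simp add: algebra_simps)
  show "m * (m - exchange_point l m) = - (l * m) * (1 - cnj (exchange_point l m) * m)"
    by (subst (1) b) (simp add: algebra_simps)
qed

text \<open>The right-hand side is real, and positive for distinct nodes, and it is symmetric in
  \<open>l\<close> and \<open>m\<close>. At the zero b = \<open>exchange_point l m\<close> the
  variation form therefore becomes a positive multiple of Re(u + v), the variation of log |l
  m|.\<close>

lemma node_weight_exchange_point:
  assumes "cmod l < 1" "cmod m < 1"
  shows "node_weight l m * critical_form (exchange_point l m) l
    = of_real ((cmod (l - m))\<^sup>2 / (1 - (cmod (l * m))\<^sup>2))"
proof -
  define N where "N = 1 - l * m * cnj (l * m)"
  have N: "N \<noteq> 0" unfolding N_def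
    by (intro one_minus_mult_cnj_nonzero cmod_mult_less_one assms)
  have b: "exchange_point l m = (l + m - l * m * cnj (l + m)) / N"
    by (simp add: exchange_point_def N_def)
  have cN: "cnj N = N" by (simp add: N_def mult.commute)
  have ne: "1 - l * cnj l \<noteq> 0" "1 - l * cnj m \<noteq> 0"
    using assms one_minus_mult_cnj_nonzero by auto
  have "critical_form (exchange_point l m) l
    = (2 * l * N - cnj (l + m - l * m * cnj (l + m)) * l\<^sup>2 - (l + m - l * m * cnj (l + m))) / N"
    unfolding critical_form_def b complex_cnj_divide cN using N by (simp add: field_simps)
  also have "2 * l * N - cnj (l + m - l * m * cnj (l + m)) * l\<^sup>2 - (l + m - l * m * cnj (l + m))
    = (l - m) * (1 - l * cnj l) * (1 - l * cnj m)"
    by (simp add: N_def algebra_simps power2_eq_square)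
  finally have "node_weight l m * critical_form (exchange_point l m) l = (l - m) * cnj (l - m) / N"
    unfolding node_weight_def using ne by simp
  also have "\<dots> = of_real ((cmod (l - m))\<^sup>2 / (1 - (cmod (l * m))\<^sup>2))"
    unfolding N_def by (simp only: complex_norm_square[symmetric] of_real_divide of_real_diff of_real_1)
  finally show ?thesis .
qed

lemma node_weight_nonzero:
  assumes "cmod l < 1" "cmod m < 1" "l \<noteq> m"
  shows "node_weight l m \<noteq> 0"
  using assms one_minus_mult_cnj_nonzero[of l l] one_minus_mult_cnj_nonzero[of l m]
  by (simp add: node_weight_def)

text \<open>By varying the direction one realises every real affine function of the zero \<open>a\<close> as the
  linearised Pick condition.\<close>

lemma variation_direction_exists:
  fixes R :: real and E :: complex
  assumes "cmod l < 1" "cmod m < 1" "l \<noteq> m"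
  obtains u v where "\<And>a. Re (u * node_weight l m * critical_form a l + v * node_weight m l * critical_form a m)
      = 2 * R - Re (a * E)"
proof -
  define N where "N = 1 - l * m * cnj (l * m)"
  have N: "N \<noteq> 0" unfolding N_def
    by (intro one_minus_mult_cnj_nonzero cmod_mult_less_one assms)
  have cN: "cnj N = N" by (simp add: N_def mult.commute)
  \<comment> \<open>With U and W the weighted directions, the constant part is 2(lU + mW), which is
    set to 2R. For A = U + W, matching the coefficient of \<open>a\<close> then requires
    \<open>A - cnj (l * m) * cnj A = B\<close>, solved next; \<open>U\<close> and \<open>W\<close>
    come from Cramer's rule.\<close>
  define B where "B = E - cnj (l + m) * of_real R"
  define A where "A = (B + cnj (l * m) * cnj B) / N"
  have A: "A - cnj (l * m) * cnj A = B"
  proof -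
    have "A - cnj (l * m) * cnj A = ((B + cnj (l * m) * cnj B) - cnj (l * m) * cnj (B + cnj (l * m) * cnj B)) / N"
      unfolding A_def complex_cnj_divide cN by (simp add: diff_divide_distrib)
    also have "(B + cnj (l * m) * cnj B) - cnj (l * m) * cnj (B + cnj (l * m) * cnj B) = B * N"
      by (simp add: N_def algebra_simps)
    finally show ?thesis using N by simp
  qed
  define U where "U = (of_real R - m * A) / (l - m)"
  define W where "W = (l * A - of_real R) / (l - m)"
  have lm: "l - m \<noteq> 0" using assms by simp
  have s0: "U + W = A" and s1: "l * U + m * W = of_real R"
  proof -
    have "U + W = (l - m) * A / (l - m)" "l * U + m * W = (l - m) * of_real R / (l - m)"
      unfolding U_def W_def times_divide_eq_right add_divide_distrib[symmetric]
      by (simp_all add: algebra_simps)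
    then show "U + W = A" "l * U + m * W = of_real R" using lm by simp_all
  qed
  have s2: "l\<^sup>2 * U + m\<^sup>2 * W = (l + m) * of_real R - l * m * A"
  proof -
    have "l\<^sup>2 * U + m\<^sup>2 * W = (l + m) * (l * U + m * W) - l * m * (U + W)"
      by (simp add: algebra_simps power2_eq_square)
    then show ?thesis unfolding s0 s1 .
  qed
  show ?thesis
  proof (rule that[of "U / node_weight l m" "W / node_weight m l"])
    fix a
    have "U / node_weight l m * node_weight l m * critical_form a l
        + W / node_weight m l * node_weight m l * critical_form a m
      = U * critical_form a l + W * critical_form a m"
      using node_weight_nonzero assms by simp
    also have "\<dots> = 2 * (l * U + m * W) - cnj a * (l\<^sup>2 * U + m\<^sup>2 * W) - a * (U + W)"
      by (simp add: critical_form_def algebra_simps)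
    also have "\<dots> = 2 * of_real R - cnj a * ((l + m) * of_real R - l * m * A) - a * A"
      unfolding s0 s1 s2 ..
    finally have e: "U / node_weight l m * node_weight l m * critical_form a l
        + W / node_weight m l * node_weight m l * critical_form a m
      = 2 * of_real R - cnj a * ((l + m) * of_real R - l * m * A) - a * A" .
    have "Re (cnj a * ((l + m) * of_real R - l * m * A)) = Re (cnj (cnj a * ((l + m) * of_real R - l * m * A)))"
      by (simp only: cnj.sel)
    also have "\<dots> = Re (a * (cnj (l + m) * of_real R - cnj (l * m) * cnj A))"
      by simp
    finally have "Re (cnj a * ((l + m) * of_real R - l * m * A)) + Re (a * A)
      = Re (a * (cnj (l + m) * of_real R + (A - cnj (l * m) * cnj A)))"
      by (simp add: algebra_simps)
    also have "\<dots> = Re (a * E)"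
      unfolding A B_def by simp
    finally show "Re (U / node_weight l m * node_weight l m * critical_form a l
        + W / node_weight m l * node_weight m l * critical_form a m) = 2 * R - Re (a * E)"
      unfolding e by simp
  qed
qed

definition extremal_zero :: "complex \<Rightarrow> complex \<Rightarrow> complex \<Rightarrow> complex \<Rightarrow> complex \<Rightarrow> complex \<Rightarrow> bool" where
  "extremal_zero x y l m h a \<longleftrightarrow> cmod a < 1 \<and> cmod h = 1 \<and>
     x = l * (h * (l - a) / (1 - cnj a * l)) \<and> y = m * (h * (m - a) / (1 - cnj a * m))"

lemma extremal_zero_exists:
  assumes gap: "pick_gap x y l m = 0"
    and lm: "l \<noteq> m" "cmod l < 1" "cmod m < 1" and xy: "cmod x < cmod l" "cmod y < cmod m"
  obtains h a where "extremal_zero x y l m h a"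
proof -
  have nz: "l \<noteq> 0" "m \<noteq> 0" using xy by auto
  have "pick_gap (l * (x / l)) (m * (y / m)) l m = 0" "cmod (x / l) < 1" "cmod (y / m) < 1"
    using gap xy nz by (auto simp: norm_divide)
  from pick_gap_eq_0_imp_automorphism[OF this(1) nz lm this(2,3)]
  obtain a h where "cmod a < 1" "cmod h = 1"
    "x / l = h * (l - a) / (1 - cnj a * l)" "y / m = h * (m - a) / (1 - cnj a * m)" by blast
  then show ?thesis using nz by (intro that[of h a]) (auto simp: extremal_zero_def field_simps)
qed

lemma pick_gap_slope_extremal_zero:
  assumes ez: "extremal_zero x y l m h a" and gap: "pick_gap x y l m = 0"
    and lm: "cmod l < 1" "cmod m < 1" and xy: "cmod x < cmod l" "cmod y < cmod m"
    and pos: "Re (u * node_weight l m * critical_form a l + v * node_weight m l * critical_form a m) > 0"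
  shows "pick_gap_slope x y l m u v > 0"
proof -
  have nz: "l \<noteq> 0" "m \<noteq> 0" using xy by auto
  define X where "X = h * (l - a) / (1 - cnj a * l)"
  define Y where "Y = h * (m - a) / (1 - cnj a * m)"
  have e: "x = l * X" "y = m * Y" "cmod h = 1" "cmod a < 1"
    using ez by (auto simp: extremal_zero_def X_def Y_def)
  have "cmod X < 1" "cmod Y < 1"
    using xy nz by (auto simp: e norm_mult)
  from pick_gap_slope_automorphism[OF X_def Y_def e(3,4) nz lm gap[unfolded e(1,2)] this, of u v]
  obtain V where "V > 0" "pick_gap_slope x y l m u v
      = V * Re (u * node_weight l m * critical_form a l + v * node_weight m l * critical_form a m)"
    unfolding e(1,2) by blast
  then show ?thesis using pos by simp
qed

text \<open>\<open>S\<close> collects the zeros of the active inequalities. A line separating it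
  from the exchange point is realised by a direction along which every active gap grows and |l m|
  decreases, while strict inequalities persist. An empty \<open>S\<close> covers the case without
  active inequality.\<close>

lemma descent_if_not_in_hull:
  assumes S: "finite S" "exchange_point l m \<notin> convex hull S"
    and lm: "l \<noteq> m" "cmod l < 1" "cmod m < 1"
    and xy: "cmod x < cmod l" "cmod y < cmod m" "cmod x' < cmod l" "cmod y' < cmod m"
    and c: "pick_gap x y l m > 0 \<or> pick_gap x y l m = 0 \<and> (\<exists>a\<in>S. \<exists>h. extremal_zero x y l m h a)"
    and c': "pick_gap x' y' l m > 0 \<or> pick_gap x' y' l m = 0 \<and> (\<exists>a\<in>S. \<exists>h. extremal_zero x' y' l m h a)"
  obtains l' m' where "pick_admissible x y l' m'" "pick_admissible x' y' l' m'"
    "cmod l' * cmod m' < cmod l * cmod m"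
proof -
  have nz: "l \<noteq> 0" "m \<noteq> 0" using xy by auto
  have "closed (convex hull S)"
    using S(1) by (simp add: finite_imp_compact_convex_hull compact_imp_closed)
  then obtain c0 \<beta> where sep: "inner c0 (exchange_point l m) < \<beta>" "\<And>a. a \<in> convex hull S \<Longrightarrow> inner c0 a > \<beta>"
    using separating_hyperplane_closed_point[OF convex_convex_hull _ S(2)] by blast
  have inn: "inner c0 a = Re (a * cnj c0)" for a
    by (simp add: inner_complex_def algebra_simps)
  \<comment> \<open>The constants make the form equal to
    \<open>inner c0 a - \<beta>\<close>.\<close>
  obtain u v where uv: "\<And>a. Re (u * node_weight l m * critical_form a l + v * node_weight m l * critical_form a m)
      = 2 * (- \<beta> / 2) - Re (a * (- cnj c0))"
    using variation_direction_exists[OF lm(2,3,1), of "- \<beta> / 2" "- cnj c0"] by blast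
  have pos: "Re (u * node_weight l m * critical_form a l + v * node_weight m l * critical_form a m) > 0" if "a \<in> S" for a
    unfolding uv using sep(2)[of a] hull_inc[OF that, of convex] by (simp add: inn)
  have "pick_gap x y l m > 0 \<or> pick_gap x y l m = 0 \<and> pick_gap_slope x y l m u v > 0"
    using c pick_gap_slope_extremal_zero[OF _ _ lm(2,3) xy(1,2) pos] by blast
  note ev1 = eventually_pick_admissible[OF xy(1,2) lm(2,3) this]
  have "pick_gap x' y' l m > 0 \<or> pick_gap x' y' l m = 0 \<and> pick_gap_slope x' y' l m u v > 0"
    using c' pick_gap_slope_extremal_zero[OF _ _ lm(2,3) xy(3,4) pos] by blast
  note ev2 = eventually_pick_admissible[OF xy(3,4) lm(2,3) this]
  have "Re (u + v) < 0"
  proof -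
    define k where "k = (cmod (l - m))\<^sup>2 / (1 - (cmod (l * m))\<^sup>2)"
    have "(cmod (l * m))\<^sup>2 < 1"
      using cmod_mult_less_one[OF lm(2,3)] by (simp add: abs_square_less_1)
    then have "k > 0" using lm by (simp add: k_def)
    have w: "node_weight l m * critical_form (exchange_point l m) l = of_real k"
      "node_weight m l * critical_form (exchange_point l m) m = of_real k"
      using node_weight_exchange_point[OF lm(2,3)] node_weight_exchange_point[OF lm(3,2)]
      by (simp_all add: k_def exchange_point_commute[of m l] norm_minus_commute mult.commute)
    have "Re (u * of_real k + v * of_real k) = - \<beta> + inner c0 (exchange_point l m)"
      using uv[of "exchange_point l m"] by (simp add: mult.assoc w inn)
    also have "\<dots> < 0" using sep(1) by simp
    finally have "k * Re (u + v) < 0" by (simp add: algebra_simps)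
    then show ?thesis using \<open>k > 0\<close> by (simp add: mult_less_0_iff)
  qed
  note ev3 = eventually_cmod_mult_less[OF nz this]
  from ev1 ev2 ev3 have "eventually (\<lambda>e. pick_admissible x y (l * (1 + of_real e * u)) (m * (1 + of_real e * v)) \<and>
      pick_admissible x' y' (l * (1 + of_real e * u)) (m * (1 + of_real e * v)) \<and>
      cmod (l * (1 + of_real e * u)) * cmod (m * (1 + of_real e * v)) < cmod l * cmod m) (at_right 0)"
    by eventually_elim auto
  from eventually_happens'[OF _ this] show ?thesis using that by auto
qed

subsection \<open>Extremal functions at an interior minimum\<close>

text \<open>The denominator is \<open>d = 1 - (cnj a + s * a) * z + s * z^2\<close>, so discs with
  equal \<open>cnj a + s * a\<close> share it, and their Cayley transforms differ only in a
  numerator that is real affine in \<open>a\<close>.\<close>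

lemma cayley_extremal_disc:
  assumes "cmod s = 1" "cmod a < 1" "cmod z < 1"
    and d: "d = (1 - cnj a * z) + s * (z * (z - a))"
  shows "d \<noteq> 0" "cayley (- s * (z * (z - a) / (1 - cnj a * z))) = 2 * (1 - cnj a * z) / d - 1"
proof -
  have n: "1 - cnj a * z \<noteq> 0" using assms one_minus_cnj_mult_nonzero by simp
  define w where "w = - s * (z * (z - a) / (1 - cnj a * z))"
  have "cmod w = cmod z * cmod (Moebius_function 0 a z)"
    using assms by (simp add: w_def Moebius_function_simple norm_mult norm_divide)
  also have "\<dots> < 1"
    using cmod_mult_less_one[OF assms(3) Moebius_function_norm_lt_1[OF assms(2,3), of 0]] by (simp add: norm_mult)
  finally have w: "1 - w \<noteq> 0" by auto
  have e: "d = (1 - cnj a * z) * (1 - w)"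
    unfolding d w_def using n by (simp add: field_simps)
  show "d \<noteq> 0" using e n w by simp
  have "cayley w = 2 / (1 - w) - 1"
    unfolding cayley_def using w by (simp add: field_simps)
  also have "2 / (1 - w) = 2 * (1 - cnj a * z) / d"
  proof -
    have "2 / (1 - w) = 2 * k / (k * (1 - w))" if "k \<noteq> 0" for k using that by simp
    from this[OF n] show ?thesis unfolding e .
  qed
  finally have "cayley w = 2 * (1 - cnj a * z) / d - 1" .
  then show "cayley (- s * (z * (z - a) / (1 - cnj a * z))) = 2 * (1 - cnj a * z) / d - 1"
    by (simp add: w_def)
qed

lemma exists_reflection: "\<exists>s. cmod s = 1 \<and> c = - s * cnj c"
proof (cases "c = 0")
  case True
  then show ?thesis by (intro exI[of _ 1]) simp
next
  case False
  then show ?thesis by (intro exI[of _ "- c / cnj c"]) (simp add: norm_divide)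
qed

lemma carath2_ge_if_between:
  fixes t :: real and a1 a2 :: complex
  assumes e1: "extremal_zero (fst p) (fst q) l m h1 a1" and e2: "extremal_zero (snd p) (snd q) l m h2 a2"
    and lm: "cmod l < 1" "cmod m < 1"
    and t: "0 \<le> t" "t \<le> 1" and b: "exchange_point l m = t * a1 + (1 - t) * a2"
  shows "elog (cmod l * cmod m) \<le> carath2 bidisc 0 p q"
proof -
  define b where "b = exchange_point l m"
  have a: "cmod a1 < 1" "cmod a2 < 1" and h: "cmod h1 = 1" "cmod h2 = 1"
    using e1 e2 by (auto simp: extremal_zero_def)
  have bt: "b = t * a1 + (1 - t) * a2" using b by (simp add: b_def)
  have "t *\<^sub>R a1 + (1 - t) *\<^sub>R a2 \<in> ball 0 1"
    using a t by (intro convexD[OF convex_ball]) auto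
  then have b1: "cmod b < 1" by (simp add: bt scaleR_conv_of_real)
  \<comment> \<open>This choice, with \<open>s = cnj \<sigma>\<close>, makes
    \<open>cnj a + s * a\<close> agree at \<open>a1\<close> and \<open>a2\<close>, hence also at
    \<open>b\<close> between them. The mean of the two discs is then the disc with zero
    \<open>b\<close>, which takes the value \<open>w = s * (l * m)\<close> at both nodes.\<close>
  obtain \<sigma> where s: "cmod \<sigma> = 1" "a1 - a2 = - \<sigma> * cnj (a1 - a2)"
    using exists_reflection by blast
  define s where "s = cnj \<sigma>"
  have ss: "cmod s = 1"
    using s(1) by (simp add: s_def)
  have refl: "cnj a1 + s * a1 = cnj a2 + s * a2"
  proof -
    have "cnj (a1 - a2) = cnj (- \<sigma> * cnj (a1 - a2))" by (rule arg_cong[OF s(2)])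
    then show ?thesis by (simp add: s_def algebra_simps)
  qed
  have hh: "h1 * cnj h1 = 1" "h2 * cnj h2 = 1"
    using h by (simp_all add: complex_norm_square[symmetric])
  define w where "w = s * (l * m)"
  have mean: "t * cayley (- s * (z * (z - a1) / (1 - cnj a1 * z))) +
      (1 - t) * cayley (- s * (z * (z - a2) / (1 - cnj a2 * z))) = cayley w" if z: "z = l \<or> z = m" for z
  proof -
    have z1: "cmod z < 1" using z lm by auto
    define d where "d = (1 - cnj b * z) + s * (z * (z - b))"
    have dd: "(1 - cnj c * z) + s * (z * (z - c)) = 1 - (cnj c + s * c) * z + s * z\<^sup>2" for c
      by (simp add: algebra_simps power2_eq_square)
    have "cnj b + s * b = t * (cnj a1 + s * a1) + (1 - t) * (cnj a2 + s * a2)"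
      by (simp add: bt algebra_simps)
    then have bb: "cnj b + s * b = cnj a1 + s * a1"
      unfolding refl[symmetric] by (simp only: distrib_right[symmetric]) simp
    have d1: "d = (1 - cnj a1 * z) + s * (z * (z - a1))" and d2: "d = (1 - cnj a2 * z) + s * (z * (z - a2))"
      unfolding d_def dd bb refl by simp_all
    have "t * cayley (- s * (z * (z - a1) / (1 - cnj a1 * z))) +
        (1 - t) * cayley (- s * (z * (z - a2) / (1 - cnj a2 * z)))
      = t * (2 * (1 - cnj a1 * z) / d - 1) + (1 - t) * (2 * (1 - cnj a2 * z) / d - 1)"
      unfolding cayley_extremal_disc(2)[OF ss a(1) z1 d1] cayley_extremal_disc(2)[OF ss a(2) z1 d2] ..
    also have "\<dots> = 2 * (t * (1 - cnj a1 * z) + (1 - t) * (1 - cnj a2 * z)) / d - 1"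
      using cayley_extremal_disc(1)[OF ss a(1) z1 d1] by (simp add: field_simps)
    also have "t * (1 - cnj a1 * z) + (1 - t) * (1 - cnj a2 * z) = 1 - cnj b * z"
      by (simp add: bt algebra_simps)
    also have "2 * (1 - cnj b * z) / d - 1 = cayley (- s * (z * (z - b) / (1 - cnj b * z)))"
      unfolding cayley_extremal_disc(2)[OF ss b1 z1 d_def] ..
    also have "- s * (z * (z - b) / (1 - cnj b * z)) = w"
    proof -
      have "z * (z - b) = - (l * m) * (1 - cnj b * z)"
        using z exchange_point_root[OF lm] unfolding b_def by auto
      then show ?thesis
        using one_minus_cnj_mult_nonzero[OF b1, of z] z1 by (simp add: w_def)
    qed
    finally show ?thesis .
  qed
  have rot: "- s * cnj h * (z * (h * (z - c) / (1 - cnj c * z))) = - s * (z * (z - c) / (1 - cnj c * z))"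
    if "h * cnj h = 1" for h z c
  proof -
    have "- s * cnj h * (z * (h * (z - c) / (1 - cnj c * z))) = (h * cnj h) * (- s * (z * (z - c) / (1 - cnj c * z)))"
      by simp
    then show ?thesis using that by simp
  qed
  have "elog (cmod w) \<le> carath2 bidisc 0 p q"
  proof (rule carath2_ge_cayley_mean[OF t, of w "- s * cnj h1" "- s * cnj h2"])
    show "cmod w < 1" using cmod_mult_less_one[OF lm] ss by (simp add: w_def norm_mult)
    show "cmod (- s * cnj h1) = 1" "cmod (- s * cnj h2) = 1"
      using ss h by (simp_all add: norm_mult)
    have xy: "fst p = l * (h1 * (l - a1) / (1 - cnj a1 * l))" "fst q = m * (h1 * (m - a1) / (1 - cnj a1 * m))"
      "snd p = l * (h2 * (l - a2) / (1 - cnj a2 * l))" "snd q = m * (h2 * (m - a2) / (1 - cnj a2 * m))"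
      using e1 e2 by (auto simp: extremal_zero_def)
    show "t * cayley (- s * cnj h1 * fst p) + (1 - t) * cayley (- s * cnj h2 * snd p) = cayley w"
      unfolding xy rot[OF hh(1)] rot[OF hh(2)] by (rule mean) simp
    show "t * cayley (- s * cnj h1 * fst q) + (1 - t) * cayley (- s * cnj h2 * snd q) = cayley w"
      unfolding xy rot[OF hh(1)] rot[OF hh(2)] by (rule mean) simp
  qed
  moreover have "cmod w = cmod l * cmod m" using ss by (simp add: w_def norm_mult)
  ultimately show ?thesis by simp
qed

text \<open>In this case the coordinate function alone has equal values at both poles and is
  extremal. This settles a minimum with just one active inequality.\<close>

lemma extremal_zero_exchange_point:
  assumes "extremal_zero x y l m h (exchange_point l m)" "cmod l < 1" "cmod m < 1"
  shows "x = y" "cmod y = cmod l * cmod m"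
proof -
  define b where "b = exchange_point l m"
  have b: "cmod b < 1" "cmod h = 1" "x = h * (l * (l - b) / (1 - cnj b * l))"
    "y = h * (m * (m - b) / (1 - cnj b * m))"
    using assms(1) by (auto simp: extremal_zero_def b_def)
  have "1 - cnj b * l \<noteq> 0" "1 - cnj b * m \<noteq> 0"
    using b assms one_minus_cnj_mult_nonzero by auto
  then have "x = - h * (l * m)" "y = - h * (l * m)"
    unfolding b(3,4) using exchange_point_root[OF assms(2,3)] by (simp_all add: b_def)
  then show "x = y" "cmod y = cmod l * cmod m"
    using b by (simp_all add: norm_mult)
qed

text \<open>Equality at one node makes a quotient value over node unimodular; Schwarz-Pick then
  forces the two quotients to agree, so the coordinate is a rotation.\<close>

lemma cmod_eq_at_unimodular_node:
  assumes adm: "pick_admissible x y l m" and lm: "l \<noteq> 0" "m \<noteq> 0" "cmod l < 1" "cmod m < 1"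
    and "cmod x = cmod l \<or> cmod y = cmod m"
  shows "cmod x = cmod l" "cmod y = cmod m"
proof -
  have "pick_admissible (l * (x / l)) (m * (y / m)) l m" using adm lm by simp
  moreover have "cmod (x / l) = 1 \<or> cmod (y / m) = 1" using assms by (auto simp: norm_divide)
  ultimately have e: "x / l = y / m" using pick_admissible_unimodular lm by blast
  then have "cmod x / cmod l = cmod y / cmod m" by (metis norm_divide)
  then show "cmod x = cmod l" "cmod y = cmod m" using assms(6) lm by (auto simp: field_simps)
qed

lemma carath2_ge_interior_minimum:
  assumes pq: "p \<in> bidisc" "q \<in> bidisc" "p \<noteq> q"
    and adm: "pick_admissible (fst p) (fst q) l m" "pick_admissible (snd p) (snd q) l m"
    and min: "\<And>l' m'. pick_admissible (fst p) (fst q) l' m' \<Longrightarrow> pick_admissible (snd p) (snd q) l' m'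
        \<Longrightarrow> cmod l * cmod m \<le> cmod l' * cmod m'"
    and lm: "l \<noteq> 0" "m \<noteq> 0" "cmod l < 1" "cmod m < 1"
  shows "elog (cmod l * cmod m) \<le> carath2 bidisc 0 p q"
proof (cases "cmod (fst p) = cmod l \<or> cmod (fst q) = cmod m")
  case True
  from cmod_eq_at_unimodular_node[OF adm(1) lm this] show ?thesis
    using carath2_ge_Moebius_product[OF holomorphic2_on_fst, of p q] pq by (auto simp: mem_bidisc)
next
  case F1: False
  show ?thesis
  proof (cases "cmod (snd p) = cmod l \<or> cmod (snd q) = cmod m")
    case True
    from cmod_eq_at_unimodular_node[OF adm(2) lm this] show ?thesis
      using carath2_ge_Moebius_product[OF holomorphic2_on_snd, of p q] pq by (auto simp: mem_bidisc)
  next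
    case False
    have st: "cmod (fst p) < cmod l" "cmod (fst q) < cmod m" "cmod (snd p) < cmod l" "cmod (snd q) < cmod m"
      using F1 False adm by (auto simp: pick_admissible_def)
    have ne: "l \<noteq> m"
      using pick_admissible_same_node adm lm pq(3) by (metis prod_eqI)
    have g: "pick_gap (fst p) (fst q) l m \<ge> 0" "pick_gap (snd p) (snd q) l m \<ge> 0"
      using adm by (auto simp: pick_admissible_def)
    have in_hull: "exchange_point l m \<in> convex hull S" if S: "finite S"
      "pick_gap (fst p) (fst q) l m > 0 \<or> (\<exists>a\<in>S. \<exists>h. extremal_zero (fst p) (fst q) l m h a)"
      "pick_gap (snd p) (snd q) l m > 0 \<or> (\<exists>a\<in>S. \<exists>h. extremal_zero (snd p) (snd q) l m h a)" for S
    proof (rule ccontr)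
      assume "exchange_point l m \<notin> convex hull S"
      from descent_if_not_in_hull[OF S(1) this ne lm(3,4) st]
      obtain l' m' where "pick_admissible (fst p) (fst q) l' m'" "pick_admissible (snd p) (snd q) l' m'"
        "cmod l' * cmod m' < cmod l * cmod m"
        using S(2,3) g by (metis order_le_less)
      then show False using min by fastforce
    qed
    have one: ?thesis if "extremal_zero (fst p) (fst q) l m h (exchange_point l m)" for h
      using extremal_zero_exchange_point[OF that lm(3,4)] carath2_ge_fst_eq[OF pq(1), of q] by simp
    have two: ?thesis if "extremal_zero (snd p) (snd q) l m h (exchange_point l m)" for h
      using extremal_zero_exchange_point[OF that lm(3,4)] carath2_ge_snd_eq[OF pq(1), of q] by simp
    consider "pick_gap (fst p) (fst q) l m > 0" "pick_gap (snd p) (snd q) l m > 0"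
      | "pick_gap (fst p) (fst q) l m = 0" "pick_gap (snd p) (snd q) l m > 0"
      | "pick_gap (fst p) (fst q) l m > 0" "pick_gap (snd p) (snd q) l m = 0"
      | "pick_gap (fst p) (fst q) l m = 0" "pick_gap (snd p) (snd q) l m = 0"
      using g by fastforce
    then show ?thesis
    proof cases
      case 1
      then show ?thesis using in_hull[of "{}"] by simp
    next
      case 2
      then obtain h a where "extremal_zero (fst p) (fst q) l m h a"
        using extremal_zero_exists[OF _ ne lm(3,4) st(1,2)] by blast
      then show ?thesis using in_hull[of "{a}"] 2 one by auto
    next
      case 3
      then obtain h a where "extremal_zero (snd p) (snd q) l m h a"
        using extremal_zero_exists[OF _ ne lm(3,4) st(3,4)] by blast
      then show ?thesis using in_hull[of "{a}"] 3 two by auto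
    next
      case 4
      then obtain h1 a1 where e1: "extremal_zero (fst p) (fst q) l m h1 a1"
        using extremal_zero_exists[OF _ ne lm(3,4) st(1,2)] by blast
      obtain h2 a2 where e2: "extremal_zero (snd p) (snd q) l m h2 a2"
        using 4 extremal_zero_exists[OF _ ne lm(3,4) st(3,4)] by blast
      have "exchange_point l m \<in> convex hull {a1, a2}"
        by (rule in_hull) (use e1 e2 in auto)
      then obtain t t' where "0 \<le> t" "0 \<le> t'" "t + t' = 1" "exchange_point l m = t *\<^sub>R a1 + t' *\<^sub>R a2"
        unfolding convex_hull_2 by blast
      moreover from this have "t' = 1 - t" by simp
      ultimately show ?thesis
        using carath2_ge_if_between[OF e1 e2 lm(3,4), of t] by (simp add: scaleR_conv_of_real)
    qed
  qed
qed

subsection \<open>Extremal functions at a boundary minimum\<close>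

lemma cmod_one_minus_real_mult_sq:
  fixes r :: real and z :: complex
  shows "(cmod (1 - r * z))\<^sup>2 = (1 - r\<^sup>2) * (1 - (cmod z)\<^sup>2) + (cmod (z - r))\<^sup>2"
  unfolding cmod_power2 by (simp add: power2_eq_square algebra_simps)

lemma boundary_quotient_gt_1:
  fixes r :: real and z :: complex
  assumes "0 < r" "r < 1" "cmod z < 1" "z \<noteq> r"
  shows "cmod ((1 - r * z) / (z - r)) > 1"
proof -
  have "(1 - r\<^sup>2) * (1 - (cmod z)\<^sup>2) > 0"
    using assms by (intro mult_pos_pos) (auto simp: abs_square_less_1 power_less_one_iff)
  then have "(cmod (z - r))\<^sup>2 < (cmod (1 - r * z))\<^sup>2"
    unfolding cmod_one_minus_real_mult_sq by simp
  then have "cmod (z - r) < cmod (1 - r * z)"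
    by (rule power2_less_imp_less) simp
  then show ?thesis using assms by (simp add: norm_divide)
qed

text \<open>The point \<open>x\<close> is the one that w -> (1 - r w)/(w - r) maps to
  \<open>n\<close>. This map sends the disc to the exterior of the closed disc, with
  \<open>r\<close> going to infinity.\<close>

lemma boundary_point:
  fixes r :: real and x z :: complex
  assumes r: "0 < r" "r < 1" and n: "cmod n = 1" and x: "x = (cnj n + r) / (1 + r * cnj n)"
  shows "1 + r * cnj n \<noteq> 0" "cmod x = 1" "1 - r * x = (1 - r\<^sup>2) / (1 + r * cnj n)"
    "z \<noteq> r \<Longrightarrow> x - z = (z - r) * (cnj n * ((1 - r * z) / (z - r)) - 1) / (1 + r * cnj n)"
proof -
  have lt: "cmod (r * cnj n) < 1" using r n by (simp add: norm_mult)
  show d: "1 + r * cnj n \<noteq> 0"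
  proof
    assume "1 + r * cnj n = 0"
    then have "r * cnj n = -1" by (simp add: add_eq_0_iff)
    then have "cmod (r * cnj n) = 1" by simp
    with lt show False by simp
  qed
  have "cmod (cnj n + r) = cmod (1 + r * cnj n)"
  proof -
    have "1 + r * cnj n = cnj n * cnj (cnj n + r)"
      using n by (simp add: algebra_simps complex_norm_square[symmetric])
    then show ?thesis using n by (metis complex_mod_cnj mult_1 norm_mult)
  qed
  then show "cmod x = 1" using d unfolding x by (simp add: norm_divide)
  show "1 - r * x = (1 - r\<^sup>2) / (1 + r * cnj n)"
    unfolding x using d by (simp add: field_simps power2_eq_square)
  assume z: "z \<noteq> r"
  have "x - z = (cnj n * (1 - r * z) - (z - r)) / (1 + r * cnj n)"
    unfolding x using d by (simp add: field_simps)
  also have "cnj n * (1 - r * z) - (z - r) = (z - r) * (cnj n * ((1 - r * z) / (z - r)) - 1)"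
    using z by (simp add: right_diff_distrib[of "z - r"])
  finally show "x - z = (z - r) * (cnj n * ((1 - r * z) / (z - r)) - 1) / (1 + r * cnj n)" .
qed

text \<open>The conclusion says that \<open>z\<close> lies strictly inside the horocycle at
  \<open>x\<close> through \<open>r\<close>, as |1 - r x| = |x - r|. Under w -> (1 - r w)/(w - r)
  this horocycle becomes the tangent line of the unit circle at \<open>n\<close>, and its inside the
  half-plane in the hypothesis \<open>sep\<close>.\<close>

lemma boundary_slope_condition:
  fixes r :: real and x z :: complex
  assumes r: "0 < r" "r < 1" and n: "cmod n = 1" and x: "x = (cnj n + r) / (1 + r * cnj n)"
    and z: "cmod z < 1" "z \<noteq> r" and sep: "Re (cnj n * ((1 - r * z) / (z - r))) > 1"
  shows "(1 - r\<^sup>2) * (cmod (x - z))\<^sup>2 < (1 - (cmod z)\<^sup>2) * (cmod (1 - r * x))\<^sup>2"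
proof -
  define Y where "Y = (1 - r * z) / (z - r)"
  define k where "k = (cmod (1 + r * cnj n))\<^sup>2"
  note bp = boundary_point[OF r n x]
  have k: "k > 0" using bp(1) by (simp add: k_def)
  have r2: "1 - r\<^sup>2 > 0" using r by (simp add: power_less_one_iff)
  have "(cmod (cnj n * Y - 1))\<^sup>2 = (cmod Y)\<^sup>2 - 2 * Re (cnj n * Y) + 1"
  proof -
    have "(cmod (w - 1))\<^sup>2 = (cmod w)\<^sup>2 - 2 * Re w + 1" for w
      unfolding cmod_power2 by (simp add: power2_eq_square algebra_simps)
    then show ?thesis using n by (simp add: norm_mult)
  qed
  then have lt: "(cmod (cnj n * Y - 1))\<^sup>2 < (cmod Y)\<^sup>2 - 1"
    using sep by (simp add: Y_def)
  have zr: "(cmod (z - r))\<^sup>2 > 0" using z by simp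
  have "(1 - r\<^sup>2) * (cmod (x - z))\<^sup>2 = (1 - r\<^sup>2) * ((cmod (z - r))\<^sup>2 * (cmod (cnj n * Y - 1))\<^sup>2) / k"
    unfolding bp(4)[OF z(2)] Y_def[symmetric] by (simp add: norm_mult norm_divide power_mult_distrib power_divide k_def)
  also have "\<dots> < (1 - r\<^sup>2) * ((cmod (z - r))\<^sup>2 * ((cmod Y)\<^sup>2 - 1)) / k"
    using lt zr k r2 by (intro divide_strict_right_mono mult_strict_left_mono) auto
  also have "(cmod (z - r))\<^sup>2 * ((cmod Y)\<^sup>2 - 1) = (1 - r\<^sup>2) * (1 - (cmod z)\<^sup>2)"
  proof -
    have "(cmod (z - r))\<^sup>2 * (cmod Y)\<^sup>2 = (cmod (1 - r * z))\<^sup>2"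
      using z by (simp add: Y_def norm_divide power_divide)
    then show ?thesis
      unfolding right_diff_distrib[of "(cmod (z - r))\<^sup>2"] using cmod_one_minus_real_mult_sq[of r z] by simp
  qed
  also have "(1 - r\<^sup>2) * ((1 - r\<^sup>2) * (1 - (cmod z)\<^sup>2)) / k = (1 - (cmod z)\<^sup>2) * (cmod (1 - r * x))\<^sup>2"
  proof -
    have "cmod (of_real 1 - (of_real r)\<^sup>2 :: complex) = 1 - r\<^sup>2"
      using r2 by (metis abs_of_pos norm_of_real of_real_diff of_real_power)
    then have "(cmod (1 - r * x))\<^sup>2 = (1 - r\<^sup>2)\<^sup>2 / k"
      unfolding bp(3) by (simp add: norm_divide power_divide k_def)
    then show ?thesis by (simp add: power2_eq_square)
  qed
  finally show ?thesis .
qed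

lemma pick_gap_unimodular_node:
  assumes "cmod l = 1"
  shows "pick_gap x y l m = (1 - (cmod x)\<^sup>2) * ((cmod m)\<^sup>2 - (cmod y)\<^sup>2) * (cmod (1 - l * cnj m))\<^sup>2"
  using assms by (simp add: pick_gap_def)

text \<open>The difference of Cayley values at \<open>w\<close> and \<open>r\<close> is k/(W - n),
  where W = (1 - r w)/(w - r). Taking reciprocals of the distances from \<open>n\<close> along the
  segment exchanges the weights: \<open>t\<close> belongs to \<open>Y1\<close> in the segment but to
  \<open>z2\<close> in the mean.\<close>

lemma cayley_mean_at_boundary:
  fixes r t :: real and Y1 Y2 x z1 z2 :: complex
  assumes r: "0 < r" "r < 1" and n: "cmod n = 1" and x: "x = (cnj n + r) / (1 + r * cnj n)"
    and z: "cmod z1 < 1" "z1 \<noteq> r" "cmod z2 < 1" "z2 \<noteq> r"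
    and Y: "Y1 = (1 - r * z1) / (z1 - r)" "Y2 = (1 - r * z2) / (z2 - r)"
    and t: "n = complex_of_real t * Y1 + (1 - complex_of_real t) * Y2"
  shows "(1 - t) * cayley (cnj x * z1) + t * cayley (cnj x * z2) = cayley (cnj x * r)"
proof -
  note bp = boundary_point[OF r n x]
  have x1: "cmod x = 1" by (rule bp(2))
  have nn: "n * cnj n = 1" "x * cnj x = 1"
    using n x1 by (simp_all add: complex_norm_square[symmetric])
  have nz: "1 - cnj x * w \<noteq> 0" if "cmod w < 1" for w
  proof
    assume "1 - cnj x * w = 0"
    then have "cmod (cnj x * w) = 1" by simp
    then show False using x1 that by (simp add: norm_mult)
  qed
  have r': "cmod (of_real r) < 1" using r by simp
  define k where "k = 2 * (1 + r * cnj n) / (cnj n * (1 - cnj x * r))"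
  have diff: "cayley (cnj x * w) - cayley (cnj x * r) = k / ((1 - r * w) / (w - r) - n)"
    if w: "cmod w < 1" "w \<noteq> r" for w :: complex
  proof -
    define W where "W = (1 - r * w) / (w - r)"
    have "W \<noteq> n" using boundary_quotient_gt_1[OF r w] n by (auto simp: W_def)
    have "cayley (cnj x * w) - cayley (cnj x * r) = 2 * (cnj x * (w - r)) / ((1 - cnj x * w) * (1 - cnj x * r))"
      unfolding cayley_def using nz[OF w(1)] nz[OF r'] by (simp add: divide_simps) (simp add: algebra_simps)
    also have "1 - cnj x * w = (cnj x * (w - r)) * (cnj n * (W - n) / (1 + r * cnj n))"
    proof -
      have "1 - cnj x * w = cnj x * (x - w)" using nn by (simp add: algebra_simps)
      also have "x - w = (w - r) * (cnj n * W - 1) / (1 + r * cnj n)"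
        unfolding W_def by (rule bp(4)[OF w(2)])
      also have "cnj n * W - 1 = cnj n * (W - n)" using nn by (simp add: algebra_simps)
      finally show ?thesis by simp
    qed
    also have "2 * (cnj x * (w - r)) / ((cnj x * (w - r)) * (cnj n * (W - n) / (1 + r * cnj n)) * (1 - cnj x * r))
        = k / (W - n)"
    proof -
      have "2 * a / (a * (b * e / c) * d) = 2 * c / (b * d) / e" if "a \<noteq> 0" for a b c d e :: complex
        using that by simp
      moreover have "cnj x * (w - r) \<noteq> 0" using w x1 by auto
      ultimately show ?thesis unfolding k_def by blast
    qed
    finally show ?thesis unfolding W_def .
  qed
  have ne: "Y1 \<noteq> n" "Y2 \<noteq> n"
    using boundary_quotient_gt_1[OF r z(1,2)] boundary_quotient_gt_1[OF r z(3,4)] n by (auto simp: Y)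
  have e1: "Y1 - n = (1 - t) * (Y1 - Y2)" and e2: "Y2 - n = - t * (Y1 - Y2)"
    by (simp_all add: t algebra_simps)
  have "1 - complex_of_real t \<noteq> 0" "complex_of_real t \<noteq> 0" "Y1 - Y2 \<noteq> 0"
    using e1 e2 ne by auto
  then have "(1 - t) * (k / (Y1 - n)) + t * (k / (Y2 - n)) = 0"
    unfolding e1 e2 by simp
  then have "(1 - t) * (cayley (cnj x * z1) - cayley (cnj x * r)) + t * (cayley (cnj x * z2) - cayley (cnj x * r)) = 0"
    unfolding diff[OF z(1,2)] diff[OF z(3,4)] Y .
  then show ?thesis by (simp add: algebra_simps)
qed

lemma rotated_value_ne:
  fixes r :: real
  assumes "0 < r" "cmod y = r" "x \<noteq> y"
  shows "x * cnj y / r \<noteq> r"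
proof
  assume "x * cnj y / r = r"
  then have "x * cnj y = of_real (r\<^sup>2)" using assms by (simp add: field_simps power2_eq_square)
  also have "\<dots> = y * cnj y" using assms complex_norm_square[of y] by simp
  finally show False using assms by auto
qed

text \<open>The unimodular node moves inwards at unit rate and the node \<open>r\<close> outwards at
  rate \<kappa>. If |y| = r, the slope is a positive multiple of \<open>\<kappa> * d - c\<close>,
  and the horocycle condition is \<open>c < d\<close>, which leaves room for some \<kappa> below
  1.\<close>

lemma boundary_gap_condition:
  fixes r :: real and n x y \<xi> :: complex
  assumes r: "0 < r" "r < 1" and n: "cmod n = 1" and \<xi>: "\<xi> = (cnj n + r) / (1 + r * cnj n)"
    and xy: "cmod x < 1" "cmod y \<le> r"
    and sep: "cmod y = r \<Longrightarrow> x \<noteq> y \<and> Re (cnj n * ((1 - r * (x * cnj y / r)) / (x * cnj y / r - r))) > 1"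
  obtains \<kappa>\<^sub>0 where "\<kappa>\<^sub>0 < 1" "\<And>\<kappa>. \<kappa> > \<kappa>\<^sub>0 \<Longrightarrow> pick_gap x y \<xi> r > 0 \<or>
      pick_gap x y \<xi> r = 0 \<and> pick_gap_slope x y \<xi> r (-1) (of_real \<kappa>) > 0"
proof (cases "cmod y = r")
  case False
  have x1: "cmod \<xi> = 1" by (rule boundary_point(2)[OF r n \<xi>])
  have "1 - \<xi> * cnj (of_real r) \<noteq> 0"
    using one_minus_cnj_mult_nonzero[of "of_real r" \<xi>] r x1 by (simp add: mult.commute)
  moreover have "(cmod x)\<^sup>2 < 1" using xy by (simp add: abs_square_less_1)
  moreover have "(cmod y)\<^sup>2 < r\<^sup>2" using xy False r by (intro power_strict_mono) auto
  ultimately have "pick_gap x y \<xi> r > 0"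
    unfolding pick_gap_unimodular_node[OF x1] using r by simp
  then show ?thesis using that[of 0] by auto
next
  case True
  \<comment> \<open>The coordinate is rotated so that \<open>y\<close> becomes
    \<open>r\<close>.\<close>
  define z where "z = x * cnj y / r"
  have x1: "cmod \<xi> = 1" by (rule boundary_point(2)[OF r n \<xi>])
  have zx: "cmod z = cmod x" using r True by (simp add: z_def norm_mult norm_divide)
  have "z \<noteq> r" unfolding z_def using rotated_value_ne[OF r(1) True] sep[OF True] by blast
  define c where "c = (1 - r\<^sup>2) * (cmod (\<xi> - z))\<^sup>2"
  define d where "d = (1 - (cmod x)\<^sup>2) * (cmod (1 - r * \<xi>))\<^sup>2"
  have cd: "c < d"
    using boundary_slope_condition[OF r n \<xi> _ \<open>z \<noteq> r\<close>] sep[OF True] xy zx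
    unfolding z_def[symmetric] c_def d_def by simp
  have "c \<ge> 0" using r by (simp add: c_def power_le_one)
  then have d: "d > 0" using cd by simp
  have "\<xi> * r - x * cnj y = r * (\<xi> - z)" using r by (simp add: z_def field_simps)
  then have e: "(cmod (\<xi> * r - x * cnj y))\<^sup>2 = r\<^sup>2 * (cmod (\<xi> - z))\<^sup>2"
    by (simp add: norm_mult power_mult_distrib)
  have slope: "pick_gap_slope x y \<xi> r (-1) (of_real \<kappa>) = 2 * r\<^sup>2 * (\<kappa> * d - c)" for \<kappa>
    unfolding pick_gap_slope_def complex_cnj_complex_of_real e
    using x1 True r by (simp add: c_def d_def mult.commute) (simp add: algebra_simps)
  show ?thesis
  proof (rule that[of "c / d"])
    show "c / d < 1" using cd d by simp
    fix \<kappa> assume "\<kappa> > c / d"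
    then have "\<kappa> * d > c" using d by (simp add: field_simps)
    then have "pick_gap_slope x y \<xi> r (-1) (of_real \<kappa>) > 0" unfolding slope using r by simp
    moreover have "pick_gap x y \<xi> r = 0" unfolding pick_gap_unimodular_node[OF x1] using True r by simp
    ultimately show "pick_gap x y \<xi> r > 0 \<or> pick_gap x y \<xi> r = 0 \<and> pick_gap_slope x y \<xi> r (-1) (of_real \<kappa>) > 0"
      by blast
  qed
qed

lemma eventually_pick_admissible_boundary:
  fixes r \<kappa> :: real
  assumes r: "0 < r" "r < 1" and \<xi>: "cmod \<xi> = 1" and xy: "cmod x < 1" "cmod y \<le> r" and \<kappa>: "\<kappa> > 0"
    and "pick_gap x y \<xi> r > 0 \<or> pick_gap x y \<xi> r = 0 \<and> pick_gap_slope x y \<xi> r (-1) (of_real \<kappa>) > 0"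
  shows "eventually (\<lambda>e. pick_admissible x y (\<xi> * (1 + of_real e * (-1))) (complex_of_real r * (1 + of_real e * of_real \<kappa>))) (at_right 0)"
proof -
  have "cmod x < cmod \<xi>" "cmod (of_real r) < 1" using xy \<xi> r by auto
  note ev = eventually_pick_gap_pos[OF assms(7)] eventually_cmod_linear_gt[OF this(1), of "-1"]
    eventually_cmod_linear[OF this(2), of "of_real \<kappa>"]
  have "eventually (\<lambda>e::real. 0 < e \<and> e < 1) (at_right 0)"
    unfolding eventually_at_right_field by (intro exI[of _ 1]) auto
  from this ev show ?thesis
  proof eventually_elim
    case (elim e)
    have "cmod (1 - of_real e) = 1 - e"
      using elim by (metis abs_of_pos diff_gt_0_iff_gt norm_of_real of_real_1 of_real_diff)
    then have "cmod (\<xi> * (1 + of_real e * (-1))) \<le> 1" using \<xi> elim by (simp add: norm_mult)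
    moreover have "cmod y \<le> cmod (of_real r * (1 + of_real e * of_real \<kappa>))"
    proof -
      have "of_real r * (1 + of_real e * of_real \<kappa>) = (of_real (r * (1 + e * \<kappa>)) :: complex)" by simp
      then have "cmod (of_real r * (1 + of_real e * of_real \<kappa>)) = r * (1 + e * \<kappa>)"
        using r elim \<kappa> by (simp only: norm_of_real) (simp add: abs_of_pos add_pos_pos)
      moreover have "r * 1 \<le> r * (1 + e * \<kappa>)" using r elim \<kappa> by (intro mult_left_mono) auto
      ultimately show ?thesis using xy by simp
    qed
    ultimately show ?case using elim by (simp add: pick_admissible_def)
  qed
qed

lemma strict_separation_from_cball:
  fixes S :: "complex set"
  assumes "finite S" "S \<noteq> {}" "convex hull S \<inter> cball 0 1 = {}"
  obtains n where "cmod n = 1" "\<And>Y. Y \<in> S \<Longrightarrow> Re (cnj n * Y) > 1"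
proof -
  have "compact (convex hull S)" using assms by (simp add: finite_imp_compact_convex_hull)
  then obtain a b where ab: "\<And>x. x \<in> cball 0 1 \<Longrightarrow> inner a x < b" "\<And>x. x \<in> convex hull S \<Longrightarrow> inner a x > b"
    using separating_hyperplane_closed_compact[of "cball 0 1" "convex hull S"] assms(2,3)
    by (metis Int_commute closed_cball convex_cball convex_convex_hull convex_hull_eq_empty)
  obtain Y0 where "Y0 \<in> S" using assms by blast
  then have "a \<noteq> 0" using ab(1)[of 0] ab(2)[of Y0] hull_inc[of Y0 S convex] by auto
  define n where "n = a / of_real (cmod a)"
  have n: "cmod n = 1" using \<open>a \<noteq> 0\<close> by (simp add: n_def norm_divide)
  have an: "a = cmod a *\<^sub>R n" using \<open>a \<noteq> 0\<close> by (simp add: n_def scaleR_conv_of_real)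
  have "inner n n = 1" using n by (simp add: power2_norm_eq_inner[symmetric])
  then have "inner a n = cmod a" by (subst (1) an) (simp only: inner_scaleR_left mult_1_right)
  then have b: "cmod a < b" using ab(1)[of n] n by simp
  show ?thesis
  proof (rule that[OF n])
    fix Y assume "Y \<in> S"
    have "b < inner a Y" by (rule ab(2)[OF hull_inc[OF \<open>Y \<in> S\<close>]])
    also have "inner a Y = cmod a * inner n Y" by (subst (1) an) (simp only: inner_scaleR_left)
    finally have "cmod a * 1 < cmod a * inner n Y" using b by simp
    then have "1 < inner n Y" using \<open>a \<noteq> 0\<close> by (metis mult_less_cancel_left_pos zero_less_norm_iff)
    then show "Re (cnj n * Y) > 1" by (simp add: inner_complex_def)
  qed
qed

lemma segment_meets_unit_circle:
  fixes Y1 Y2 :: complex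
  assumes "cmod Y1 > 1" "cmod (complex_of_real s * Y1 + (1 - complex_of_real s) * Y2) \<le> 1" "0 \<le> s" "s \<le> (1::real)"
  obtains t :: real where "0 \<le> t" "t \<le> 1" "cmod (complex_of_real t * Y1 + (1 - complex_of_real t) * Y2) = 1"
proof -
  have "continuous_on {s..1} (\<lambda>t::real. cmod (complex_of_real t * Y1 + (1 - complex_of_real t) * Y2))"
    by (intro continuous_intros)
  from IVT'[of "\<lambda>t::real. cmod (complex_of_real t * Y1 + (1 - complex_of_real t) * Y2)" s 1 1, OF _ _ _ this] assms
  obtain t where "s \<le> t" "t \<le> 1" "cmod (complex_of_real t * Y1 + (1 - complex_of_real t) * Y2) = 1" by auto
  then show ?thesis using that[of t] assms by simp
qed

text \<open>For an active coordinate, i.e. one with |y| = r, the quotient \<open>Q x y\<close>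
  describes its horocycle condition. If the hull of these quotients missed the closed disc, the
  normal of a separating line would give a boundary node and a descent direction. So the hull meets
  the disc, and a point of the segment on the circle supplies the extremal function.\<close>

lemma carath2_ge_boundary_minimum:
  assumes pq: "p \<in> bidisc" "q \<in> bidisc" and r: "r = max (cmod (fst q)) (cmod (snd q))" "0 < r"
    and min: "\<And>l m. pick_admissible (fst p) (fst q) l m \<Longrightarrow> pick_admissible (snd p) (snd q) l m
        \<Longrightarrow> r \<le> cmod l * cmod m"
  shows "elog r \<le> carath2 bidisc 0 p q"
proof -
  have r1: "r < 1" and x: "cmod (fst p) < 1" "cmod (snd p) < 1" and y: "cmod (fst q) \<le> r" "cmod (snd q) \<le> r"
    using pq r by (auto simp: mem_bidisc)
  define Z where "Z = (\<lambda>x y. x * cnj y / complex_of_real r)"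
  define Q where "Q = (\<lambda>x y. (1 - r * Z x y) / (Z x y - r))"
  have Z: "cmod (Z x y) = cmod x" if "cmod y = r" for x y
    using r(2) that by (simp add: Z_def norm_mult norm_divide)
  have Zr: "Z x y \<noteq> r" if "cmod y = r" "x \<noteq> y" for x y
    unfolding Z_def using rotated_value_ne[OF r(2) that] .
  have Q1: "cmod (Q x y) > 1" if "cmod y = r" "x \<noteq> y" "cmod x < 1" for x y
    unfolding Q_def using boundary_quotient_gt_1[OF r(2) r1 _ Zr[OF that(1,2)]] Z that by simp
  consider "cmod (fst q) = r" "fst p = fst q" | "cmod (snd q) = r" "snd p = snd q"
    | "cmod (fst q) = r \<Longrightarrow> fst p \<noteq> fst q" "cmod (snd q) = r \<Longrightarrow> snd p \<noteq> snd q" by blast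
  then show ?thesis
  proof cases
    case 1
    then show ?thesis using carath2_ge_fst_eq[OF pq(1), of q] by simp
  next
    case 2
    then show ?thesis using carath2_ge_snd_eq[OF pq(1), of q] by simp
  next
    case 3
    define S where "S = (if cmod (fst q) = r then {Q (fst p) (fst q)} else {}) \<union>
      (if cmod (snd q) = r then {Q (snd p) (snd q)} else {})"
    have S: "finite S" "S \<noteq> {}" using r(1) by (auto simp: S_def max_def split: if_splits)
    have "convex hull S \<inter> cball 0 1 \<noteq> {}"
    proof
      assume "convex hull S \<inter> cball 0 1 = {}"
      from strict_separation_from_cball[OF S this]
      obtain n where n: "cmod n = 1" "\<And>Y. Y \<in> S \<Longrightarrow> Re (cnj n * Y) > 1" by blast
      define \<xi> where "\<xi> = (cnj n + r) / (1 + r * cnj n)"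
      have \<xi>1: "cmod \<xi> = 1" by (rule boundary_point(2)[OF r(2) r1 n(1) \<xi>_def])
      have s1: "fst p \<noteq> fst q \<and> Re (cnj n * ((1 - r * (fst p * cnj (fst q) / r)) / (fst p * cnj (fst q) / r - r))) > 1"
        if "cmod (fst q) = r"
        using 3(1)[OF that] n(2)[of "Q (fst p) (fst q)"] that by (simp add: S_def Q_def Z_def)
      have s2: "snd p \<noteq> snd q \<and> Re (cnj n * ((1 - r * (snd p * cnj (snd q) / r)) / (snd p * cnj (snd q) / r - r))) > 1"
        if "cmod (snd q) = r"
        using 3(2)[OF that] n(2)[of "Q (snd p) (snd q)"] that by (simp add: S_def Q_def Z_def)
      obtain k1 where k1: "k1 < 1" "\<And>\<kappa>. \<kappa> > k1 \<Longrightarrow> pick_gap (fst p) (fst q) \<xi> r > 0 \<or>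
          pick_gap (fst p) (fst q) \<xi> r = 0 \<and> pick_gap_slope (fst p) (fst q) \<xi> r (-1) (of_real \<kappa>) > 0"
        using boundary_gap_condition[OF r(2) r1 n(1) \<xi>_def x(1) y(1) s1] by blast
      obtain k2 where k2: "k2 < 1" "\<And>\<kappa>. \<kappa> > k2 \<Longrightarrow> pick_gap (snd p) (snd q) \<xi> r > 0 \<or>
          pick_gap (snd p) (snd q) \<xi> r = 0 \<and> pick_gap_slope (snd p) (snd q) \<xi> r (-1) (of_real \<kappa>) > 0"
        using boundary_gap_condition[OF r(2) r1 n(1) \<xi>_def x(2) y(2) s2] by blast
      \<comment> \<open>\<kappa> > 0 keeps the second node at modulus at least \<open>r\<close>, the
        bounds \<open>k1\<close> and \<open>k2\<close> keep both gaps positive, and \<kappa> < 1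
        makes |l m| decrease.\<close>
      obtain \<kappa> where \<kappa>: "max 0 (max k1 k2) < \<kappa>" "\<kappa> < 1"
        using dense[of "max 0 (max k1 k2)" 1] k1 k2 by auto
      have ev1: "eventually (\<lambda>e. pick_admissible (fst p) (fst q) (\<xi> * (1 + of_real e * (-1))) (complex_of_real r * (1 + of_real e * of_real \<kappa>))) (at_right 0)"
        using \<kappa> k1 by (intro eventually_pick_admissible_boundary[OF r(2) r1 \<xi>1 x(1) y(1)]) auto
      have ev2: "eventually (\<lambda>e. pick_admissible (snd p) (snd q) (\<xi> * (1 + of_real e * (-1))) (complex_of_real r * (1 + of_real e * of_real \<kappa>))) (at_right 0)"
        using \<kappa> k2 by (intro eventually_pick_admissible_boundary[OF r(2) r1 \<xi>1 x(2) y(2)]) auto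
      have ev3: "eventually (\<lambda>e. cmod (\<xi> * (1 + of_real e * (-1))) * cmod (complex_of_real r * (1 + of_real e * of_real \<kappa>)) < cmod \<xi> * cmod (of_real r)) (at_right 0)"
        using \<xi>1 r \<kappa> by (intro eventually_cmod_mult_less) auto
      from ev1 ev2 ev3 have "eventually (\<lambda>e::real. False) (at_right 0)"
      proof eventually_elim
        case (elim e)
        from min[OF elim(1,2)] elim(3) \<xi>1 r(2) show False by simp
      qed
      then show False by simp
    qed
    then obtain Y where Y: "Y \<in> convex hull S" "cmod Y \<le> 1" by auto
    have Sgt: "cmod Y' > 1" if "Y' \<in> S" for Y'
      using that Q1[OF _ 3(1) x(1)] Q1[OF _ 3(2) x(2)] by (auto simp: S_def split: if_splits)
    have both: "cmod (fst q) = r" "cmod (snd q) = r"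
    proof -
      \<comment> \<open>Each quotient lies outside the closed disc, so the hull can only meet it if
        both coordinates are active.\<close>
      have "S \<noteq> {Y'}" for Y' using Y Sgt[of Y'] by auto
      then show "cmod (fst q) = r" "cmod (snd q) = r"
        using S by (auto simp: S_def split: if_splits)
    qed
    define Y1 where "Y1 = Q (fst p) (fst q)"
    define Y2 where "Y2 = Q (snd p) (snd q)"
    have "S = {Y1, Y2}" using both by (auto simp: S_def Y1_def Y2_def)
    then have "Y \<in> convex hull {Y1, Y2}" using Y(1) by simp
    then obtain s s' where s: "0 \<le> s" "0 \<le> s'" "s + s' = 1" "Y = s *\<^sub>R Y1 + s' *\<^sub>R Y2"
      unfolding convex_hull_2 by blast
    moreover from this have "s' = 1 - s" by simp
    ultimately have "cmod (complex_of_real s * Y1 + (1 - complex_of_real s) * Y2) \<le> 1" "s \<le> 1"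
      using Y(2) by (auto simp: scaleR_conv_of_real)
    moreover have "cmod Y1 > 1" using Sgt both by (simp add: S_def Y1_def)
    ultimately obtain t where t: "0 \<le> t" "t \<le> 1" "cmod (complex_of_real t * Y1 + (1 - complex_of_real t) * Y2) = 1"
      using segment_meets_unit_circle[of Y1 s Y2, OF _ _ s(1)] by metis
    define n where "n = complex_of_real t * Y1 + (1 - complex_of_real t) * Y2"
    define \<xi> where "\<xi> = (cnj n + r) / (1 + r * cnj n)"
    have n1: "cmod n = 1" using t(3) by (simp add: n_def)
    have \<xi>1: "cmod \<xi> = 1" by (rule boundary_point(2)[OF r(2) r1 n1 \<xi>_def])
    have zs: "cmod (Z (fst p) (fst q)) < 1" "Z (fst p) (fst q) \<noteq> r" "cmod (Z (snd p) (snd q)) < 1" "Z (snd p) (snd q) \<noteq> r"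
      using Z Zr both 3 x by auto
    have mean: "(1 - t) * cayley (cnj \<xi> * Z (fst p) (fst q)) + t * cayley (cnj \<xi> * Z (snd p) (snd q)) = cayley (cnj \<xi> * r)"
      by (rule cayley_mean_at_boundary[OF r(2) r1 n1 \<xi>_def zs Y1_def[unfolded Q_def] Y2_def[unfolded Q_def] n_def])
    have qq: "cnj y / r * y = r" if "cmod y = r" for y
      using that r(2) complex_norm_square[of y] by (simp add: field_simps power2_eq_square)
    have "elog (cmod (cnj \<xi> * r)) \<le> carath2 bidisc 0 p q"
    \<comment> \<open>The rotations send both coordinates of \<open>q\<close> to
      \<open>cnj \<xi> * r\<close>, so the condition at \<open>q\<close> is trivial; the condition
      at \<open>p\<close> is \<open>mean\<close>.\<close>
    proof (rule carath2_ge_cayley_mean[of "1 - t" _ "cnj \<xi> * (cnj (fst q) / r)" "cnj \<xi> * (cnj (snd q) / r)"])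
      show "0 \<le> 1 - t" "1 - t \<le> 1" using t by auto
      show "cmod (cnj \<xi> * r) < 1" using \<xi>1 r(2) r1 by (simp add: norm_mult)
      show "cmod (cnj \<xi> * (cnj (fst q) / r)) = 1" "cmod (cnj \<xi> * (cnj (snd q) / r)) = 1"
        using \<xi>1 r(2) both by (simp_all add: norm_mult norm_divide)
      have "cnj \<xi> * (cnj y / r) * x = cnj \<xi> * Z x y" for x y by (simp add: Z_def)
      then show "complex_of_real (1 - t) * cayley (cnj \<xi> * (cnj (fst q) / r) * fst p) +
          complex_of_real (1 - (1 - t)) * cayley (cnj \<xi> * (cnj (snd q) / r) * snd p) = cayley (cnj \<xi> * r)"
        using mean by simp
      show "complex_of_real (1 - t) * cayley (cnj \<xi> * (cnj (fst q) / r) * fst q) +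
          complex_of_real (1 - (1 - t)) * cayley (cnj \<xi> * (cnj (snd q) / r) * snd q) = cayley (cnj \<xi> * r)"
        unfolding mult.assoc qq[OF both(1)] qq[OF both(2)] by (simp add: algebra_simps)
    qed
    then show ?thesis using \<xi>1 r(2) by (simp add: norm_mult)
  qed
qed

subsection \<open>Existence of a minimum and conclusion\<close>

text \<open>The nodes 1 and \<open>s\<close> with s > r give strictly positive gaps. These persist
  when the node 1 is moved slightly into the disc, where a genuine disc exists; then
  \<open>s\<close> tends to \<open>r\<close>.\<close>

lemma lempert2_le_sup_norm:
  assumes pq: "p \<in> bidisc" "q \<in> bidisc" "p \<noteq> q" and r: "r = max (cmod (fst q)) (cmod (snd q))" "0 < r"
  shows "lempert2 bidisc 0 p q \<le> elog r"
proof -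
  have r1: "r < 1" and x: "cmod (fst p) < 1" "cmod (snd p) < 1" and y: "cmod (fst q) \<le> r" "cmod (snd q) \<le> r"
    using pq r by (auto simp: mem_bidisc)
  have le: "lempert2 bidisc 0 p q \<le> elog s" if s: "r < s" "s < 1" for s
  proof -
    have s0: "s > 0" using s(1) r(2) by linarith
    have ev: "eventually (\<lambda>e. pick_gap x y (1 * (1 + of_real e * (-1))) (of_real s * (1 + of_real e * 0)) > 0
        \<and> cmod x < cmod (1 * (1 + of_real e * (-1)) :: complex)) (at_right 0)"
      if "cmod x < 1" "cmod y \<le> r" for x y
    proof (intro eventually_conj eventually_pick_gap_pos eventually_cmod_linear_gt disjI1)
      have "(cmod x)\<^sup>2 < 1" "(cmod y)\<^sup>2 < s\<^sup>2"
        using that s s0 by (auto simp: abs_square_less_1 intro!: power_strict_mono)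
      moreover have "1 - complex_of_real s \<noteq> 0"
        using s by (metis eq_iff_diff_eq_0 less_irrefl of_real_eq_1_iff)
      ultimately show "pick_gap x y 1 (of_real s) > 0"
        unfolding pick_gap_unimodular_node[OF norm_one] using s0 by simp
    qed (use that in simp)
    have "eventually (\<lambda>e::real. 0 < e \<and> e < 1) (at_right 0)"
      unfolding eventually_at_right_field by (intro exI[of _ 1]) auto
    from eventually_conj[OF this eventually_conj[OF ev[OF x(1) y(1)] ev[OF x(2) y(2)]]]
    obtain e :: real where e: "0 < e" "e < 1"
      "pick_gap (fst p) (fst q) (1 - of_real e) (of_real s) > 0" "cmod (fst p) < cmod (1 - of_real e)"
      "pick_gap (snd p) (snd q) (1 - of_real e) (of_real s) > 0" "cmod (snd p) < cmod (1 - of_real e)"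
      using eventually_happens'[of "at_right (0::real)"] by (auto simp: trivial_limit_at_right_real)
    have n: "cmod (1 - of_real e) = 1 - e"
      using e by (metis abs_of_pos diff_gt_0_iff_gt norm_of_real of_real_1 of_real_diff)
    have "lempert2 bidisc 0 p q \<le> elog (cmod (1 - of_real e) * cmod (of_real s))"
      using e s s0 y n
      by (intro lempert2_le_admissible) (auto simp: pick_admissible_def pq)
    also have "\<dots> \<le> elog s"
      using e s0 n by (intro elog_mono) (auto simp: mult_le_cancel_right2)
    finally show ?thesis .
  qed
  have "eventually (\<lambda>s. lempert2 bidisc 0 p q \<le> elog s) (at_right r)"
    unfolding eventually_at_right_field using r1 le by blast
  moreover have "(elog \<longlongrightarrow> elog r) (at_right r)"
  proof (rule Lim_transform_eventually)
    have "((\<lambda>s. ereal (ln s)) \<longlongrightarrow> ereal (ln r)) (at_right r)"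
      using r by (intro tendsto_intros) auto
    then show "((\<lambda>s. ereal (ln s)) \<longlongrightarrow> elog r) (at_right r)" using r by (simp add: elog_def)
    show "eventually (\<lambda>s. ereal (ln s) = elog s) (at_right r)"
      unfolding eventually_at_right_field using r by (intro exI[of _ "r + 1"]) (auto simp: elog_def)
  qed
  ultimately show ?thesis
    by (intro tendsto_lowerbound[where F = "at_right r"]) auto
qed

lemma pick_gap_commute: "pick_gap x y l m = pick_gap y x m l"
proof -
  have "cnj (1 - l * cnj m) = 1 - m * cnj l" "cnj (l * cnj m - x * cnj y) = m * cnj l - y * cnj x"
    by (simp_all add: mult.commute)
  then have "cmod (1 - l * cnj m) = cmod (1 - m * cnj l)"
    "cmod (l * cnj m - x * cnj y) = cmod (m * cnj l - y * cnj x)"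
    by (metis complex_mod_cnj)+
  then show ?thesis by (simp add: pick_gap_def mult_ac)
qed

lemma pick_admissible_commute: "pick_admissible x y l m \<longleftrightarrow> pick_admissible y x m l"
  unfolding pick_admissible_def pick_gap_commute[of x y l m] by blast

lemma carath2_commute: "carath2 D z p q = carath2 D z q p"
  unfolding carath2_def by (intro arg_cong[where f = Sup]) blast

lemma lempert2_commute: "lempert2 D z p q = lempert2 D z q p"
proof -
  have "{elog (cmod a1) + elog (cmod a2) | a1 a2 \<psi>.
      holomorphic_map2_on \<psi> (ball 0 1) \<and> \<psi> ` ball 0 1 \<subseteq> D \<and>
      a1 \<in> ball 0 1 \<and> a2 \<in> ball 0 1 \<and> \<psi> 0 = z \<and> \<psi> a1 = p \<and> \<psi> a2 = q}
    \<subseteq> {elog (cmod a1) + elog (cmod a2) | a1 a2 \<psi>.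
      holomorphic_map2_on \<psi> (ball 0 1) \<and> \<psi> ` ball 0 1 \<subseteq> D \<and>
      a1 \<in> ball 0 1 \<and> a2 \<in> ball 0 1 \<and> \<psi> 0 = z \<and> \<psi> a1 = q \<and> \<psi> a2 = p}" for p q
    by (clarify, metis (no_types, lifting) add.commute)
  then show ?thesis
    unfolding lempert2_def by (intro arg_cong[where f = Inf] equalityI)
qed

lemma pick_admissible_boundary:
  fixes r :: real
  assumes "cmod x < 1" "cmod y \<le> r" "r < 1"
  shows "pick_admissible x y 1 (of_real r)"
proof -
  have "0 \<le> r" using assms(2) norm_ge_zero order_trans by blast
  moreover have "(cmod x)\<^sup>2 \<le> 1" "(cmod y)\<^sup>2 \<le> r\<^sup>2"
    using assms by (auto simp: power_le_one intro: power_mono)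
  ultimately show ?thesis
    using assms pick_gap_unimodular_node[OF norm_one, of x y "of_real r"] by (simp add: pick_admissible_def)
qed

lemma compact_pick_admissible: "compact {w. pick_admissible x y (fst w) (snd w)}"
proof -
  have "closed {w. pick_admissible x y (fst w) (snd w)}"
    unfolding pick_admissible_def pick_gap_def
    by (intro closed_Collect_conj closed_Collect_le continuous_intros)
  moreover have "{w. pick_admissible x y (fst w) (snd w)} \<subseteq> cball 0 1 \<times> cball 0 1"
    by (auto simp: pick_admissible_def)
  then have "bounded {w. pick_admissible x y (fst w) (snd w)}"
    by (rule bounded_subset[rotated]) (intro bounded_Times bounded_cball)
  ultimately show ?thesis by (simp add: compact_eq_bounded_closed)
qed

text \<open>Admissibility forces |m| \<ge> r, so with |l| = 1 the minimal value is at least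
  \<open>r\<close>, and both functions can be compared with \<open>elog r\<close>.\<close>

lemma lempert2_le_carath2_boundary:
  assumes pq: "p \<in> bidisc" "q \<in> bidisc" "p \<noteq> q" "q \<noteq> 0"
    and adm: "pick_admissible (fst p) (fst q) l m" "pick_admissible (snd p) (snd q) l m"
    and min: "\<And>l' m'. pick_admissible (fst p) (fst q) l' m' \<Longrightarrow> pick_admissible (snd p) (snd q) l' m'
        \<Longrightarrow> cmod l * cmod m \<le> cmod l' * cmod m'"
    and l: "cmod l = 1"
  shows "lempert2 bidisc 0 p q \<le> carath2 bidisc 0 p q"
proof -
  define r where "r = max (cmod (fst q)) (cmod (snd q))"
  have r0: "0 < r" using pq(4) by (cases q) (auto simp: r_def less_max_iff_disj zero_prod_def)
  have r1: "r < 1" using pq by (auto simp: r_def mem_bidisc)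
  have "r \<le> cmod m" using adm by (auto simp: r_def pick_admissible_def)
  then have "r \<le> cmod l' * cmod m'" if "pick_admissible (fst p) (fst q) l' m'" "pick_admissible (snd p) (snd q) l' m'" for l' m'
    using min[OF that] l by simp
  from carath2_ge_boundary_minimum[OF pq(1,2) r_def r0 this]
  have "elog r \<le> carath2 bidisc 0 p q" .
  with lempert2_le_sup_norm[OF pq(1-3) r_def r0] show ?thesis by (rule order_trans)
qed

lemma lempert2_le_carath2_origin:
  assumes pq: "p \<in> bidisc" "q \<in> bidisc" "p \<noteq> q" "p \<noteq> 0" "q \<noteq> 0"
  shows "lempert2 bidisc 0 p q \<le> carath2 bidisc 0 p q"
proof -
  define K where "K = {w. pick_admissible (fst p) (fst q) (fst w) (snd w)} \<inter> {w. pick_admissible (snd p) (snd q) (fst w) (snd w)}"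
  have "compact K"
    unfolding K_def by (intro compact_Int compact_pick_admissible)
  define r where "r = max (cmod (fst q)) (cmod (snd q))"
  have "(1, of_real r) \<in> K"
    using pq by (auto simp: K_def r_def mem_bidisc intro!: pick_admissible_boundary)
  then have "K \<noteq> {}" by blast
  have "continuous_on K (\<lambda>w. cmod (fst w) * cmod (snd w))" by (intro continuous_intros)
  from continuous_attains_inf[OF \<open>compact K\<close> \<open>K \<noteq> {}\<close> this]
  obtain w where w: "w \<in> K" "\<And>w'. w' \<in> K \<Longrightarrow> cmod (fst w) * cmod (snd w) \<le> cmod (fst w') * cmod (snd w')"
    by blast
  define l where "l = fst w"
  define m where "m = snd w"
  have adm: "pick_admissible (fst p) (fst q) l m" "pick_admissible (snd p) (snd q) l m"
    using w(1) by (auto simp: K_def l_def m_def)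
  have min: "cmod l * cmod m \<le> cmod l' * cmod m'"
    if "pick_admissible (fst p) (fst q) l' m'" "pick_admissible (snd p) (snd q) l' m'" for l' m'
    using w(2)[of "(l', m')"] that by (simp add: K_def l_def m_def)
  have nz: "l \<noteq> 0" "m \<noteq> 0"
    using adm pq(4,5) by (auto simp: pick_admissible_def prod_eq_iff)
  consider "cmod l = 1" | "cmod m = 1" | "cmod l < 1" "cmod m < 1"
    using adm by (fastforce simp: pick_admissible_def)
  then show ?thesis
  proof cases
    case 1
    then show ?thesis using lempert2_le_carath2_boundary[OF pq(1-3,5) adm min] by blast
  next
    case 2
    have "lempert2 bidisc 0 q p \<le> carath2 bidisc 0 q p"
    proof (rule lempert2_le_carath2_boundary[OF pq(2,1) pq(3)[symmetric] pq(4) _ _ _ 2])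
      show "pick_admissible (fst q) (fst p) m l" "pick_admissible (snd q) (snd p) m l"
        using adm pick_admissible_commute by blast+
      show "cmod m * cmod l \<le> cmod l' * cmod m'"
        if "pick_admissible (fst q) (fst p) l' m'" "pick_admissible (snd q) (snd p) l' m'" for l' m'
        using min[of m' l'] that pick_admissible_commute by (simp add: mult.commute)
    qed
    then show ?thesis by (simp add: carath2_commute[of _ _ p] lempert2_commute[of _ _ p])
  next
    case 3
    have "lempert2 bidisc 0 p q \<le> elog (cmod l * cmod m)"
      by (rule lempert2_le_admissible[OF adm 3 nz pq(3)])
    also have "\<dots> \<le> carath2 bidisc 0 p q"
      by (rule carath2_ge_interior_minimum[OF pq(1-3) adm min nz 3])
    finally show ?thesis .
  qed
qed

text \<open>The node of the pole at the base point can be 0, which contributes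
  \<open>elog 0\<close>; a linear disc through \<open>q\<close> reaches the other pole.\<close>

lemma lempert2_at_pole:
  assumes "q \<in> bidisc"
  shows "lempert2 bidisc 0 0 q = -\<infinity>"
proof -
  \<comment> \<open>A positive number between the maximum norm of \<open>q\<close> and 1, also when
    \<open>q\<close> is 0.\<close>
  define r where "r = (max (cmod (fst q)) (cmod (snd q)) + 1) / 2"
  have r: "0 < r" "r < 1" "cmod (fst q) \<le> r" "cmod (snd q) \<le> r"
    using assms by (auto simp: r_def mem_bidisc max_def add_nonneg_pos)
  define \<psi> where "\<psi> = (\<lambda>t::complex. (t * (fst q / r), t * (snd q / r)))"
  have "holomorphic_map2_on \<psi> (ball 0 1)"
    unfolding holomorphic_map2_on_def \<psi>_def fst_conv snd_conv by (intro conjI holomorphic_intros)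
  moreover have "\<psi> ` ball 0 1 \<subseteq> bidisc"
  proof (rule image_subsetI)
    fix t :: complex assume "t \<in> ball 0 1"
    moreover have "cmod (t * (c / r)) \<le> cmod t * 1" if "cmod c \<le> r" for c
      unfolding norm_mult using r that by (intro mult_left_mono) (auto simp: norm_divide)
    ultimately show "\<psi> t \<in> bidisc"
      using r by (auto simp: \<psi>_def mem_bidisc intro: le_less_trans)
  qed
  moreover have "\<psi> 0 = 0" "\<psi> (of_real r) = q"
    using r by (auto simp: \<psi>_def zero_prod_def)
  ultimately have "lempert2 bidisc 0 0 q \<le> elog (cmod 0) + elog (cmod (of_real r))"
    unfolding lempert2_def using r
    by (intro Inf_lower CollectI exI[of _ 0] exI[of _ "of_real r"] exI[of _ \<psi>]) auto
  also have "\<dots> = -\<infinity>" using r by (simp add: elog_def)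
  finally show ?thesis by simp
qed

theorem theorem1:
  assumes "p \<in> bidisc" and "q \<in> bidisc" and "p \<noteq> q"
  shows "\<forall>z\<in>bidisc. carath2 bidisc z p q = lempert2 bidisc z p q"
proof
  fix z assume z: "z \<in> bidisc"
  define p' where "p' = bidisc_moebius z p"
  define q' where "q' = bidisc_moebius z q"
  have m: "p' \<in> bidisc" "q' \<in> bidisc"
    unfolding p'_def q'_def by (intro bidisc_moebius_mem z assms)+
  have ne: "p' \<noteq> q'"
    unfolding p'_def q'_def using bidisc_moebius_cancel[OF z] assms by metis
  have "lempert2 bidisc 0 p' q' \<le> carath2 bidisc 0 p' q'"
  proof (cases "p' = 0 \<or> q' = 0")
    case True
    then have "lempert2 bidisc 0 p' q' = -\<infinity>"
      using lempert2_at_pole m lempert2_commute by metis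
    then show ?thesis by simp
  next
    case False
    then show ?thesis using lempert2_le_carath2_origin[OF m ne] by blast
  qed
  then have "lempert2 bidisc z p q \<le> carath2 bidisc z p q"
    using lempert2_le_recentered[OF z assms(1,2)] carath2_recentered_le[OF z assms(1,2)]
    unfolding p'_def q'_def by (meson order_trans)
  with carath2_le_lempert2[OF assms(3)] show "carath2 bidisc z p q = lempert2 bidisc z p q"
    by (rule antisym)
qed

end
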